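(* For open shop systems in which every machine has capacity $1$, the problem Reachable Deadlock — decide whether the system can reach a deadlock state starting from the initial state $0$ — can be solved in polynomial time.
   Context: An open shop system consists of $n$ jobs $J_1,\ldots,J_n$ and $m$ machines $M_1,\ldots,M_m$. Each job $J_j$ has a set $\mathcal{M}(J_j)\subseteq\{M_1,\ldots,M_m\}$ of machines on which it must be processed, in an arbitrary order; each machine $M_i$ has a positive integer capacity $\mathrm{cap}(M_i)$. There are two artificial machines $M_0$ and $M_{m+1}$ of unbounded capacity. A state $s$ specifies for every job $J_j$ a machine $M^s(J_j)\in\{M_0,\ldots,M_{m+1}\}$ on which it currently sits and a set $\mathcal{M}^s(J_j)\subseteq\mathcal{M}(J_j)\setminus\{M^s(J_j)\}$ of machines on which it still needs processing; each machine $M_i$, $1\le i\le m$, holds at most $\mathrm{cap}(M_i)$ jobs. The initial state $0$ has $M^0(J_j)=M_0$, $\mathcal{M}^0(J_j)=\mathcal{M}(J_j)$; the final state $f$ has $M^f(J_j)=M_{m+1}$, $\mathcal{M}^f(J_j)=\emptyset$ for all $j$. A successor of $s$ arises by moving a single job $J_j$ from $M^s(J_j)$ to a machine $M\in\mathcal{M}^s(J_j)$ holding fewer than $\mathrm{cap}(M)$ jobs (removing $M$ from its remaining set), or by moving a job with $\mathcal{M}^s(J_j)=\emptyset$, $M^s(J_j)\ne M_{m+1}$ to $M_{m+1}$. A deadlock is a state other than $f$ with no successor; reaching means via finitely many successor steps. *)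

theory Defs
  imports Main "HOL-Computational_Algebra.Polynomial"
begin

section \<open>Open shop systems\<close>

text \<open>
  Jobs are numbered \<open>1, \<dots>, n\<close> and machines \<open>1, \<dots>, m\<close>; \<open>0\<close> and \<open>m + 1\<close> are the two
  artificial machines. The fields \<open>needs\<close> and \<open>cap\<close> are meaningful only on these ranges.
\<close>

record open_shop =
  njobs :: nat
  nmachines :: nat
  needs :: "nat \<Rightarrow> nat set"
  cap :: "nat \<Rightarrow> nat"

definition open_shop_system :: "open_shop \<Rightarrow> bool" where
  "open_shop_system S \<longleftrightarrow>
     (\<forall>j\<in>{1..njobs S}. needs S j \<subseteq> {1..nmachines S}) \<and>
     (\<forall>i\<in>{1..nmachines S}. 0 < cap S i)"

record shop_state =
  loc :: "nat \<Rightarrow> nat"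
  rem :: "nat \<Rightarrow> nat set"

definition load :: "open_shop \<Rightarrow> shop_state \<Rightarrow> nat \<Rightarrow> nat" where
  "load S s i = card {j \<in> {1..njobs S}. loc s j = i}"

definition is_state :: "open_shop \<Rightarrow> shop_state \<Rightarrow> bool" where
  "is_state S s \<longleftrightarrow>
     (\<forall>j\<in>{1..njobs S}. loc s j \<le> nmachines S + 1 \<and> rem s j \<subseteq> needs S j - {loc s j}) \<and>
     (\<forall>i\<in>{1..nmachines S}. load S s i \<le> cap S i)"

definition initial_state :: "open_shop \<Rightarrow> shop_state" where
  "initial_state S = \<lparr>loc = (\<lambda>j. 0), rem = needs S\<rparr>"

text \<open>
  The final state is given as a predicate because a \<open>shop_state\<close> also carries irrelevant values
  outside the job range.
\<close>

definition is_final :: "open_shop \<Rightarrow> shop_state \<Rightarrow> bool" where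
  "is_final S s \<longleftrightarrow> (\<forall>j\<in>{1..njobs S}. loc s j = nmachines S + 1 \<and> rem s j = {})"

definition successor :: "open_shop \<Rightarrow> shop_state \<Rightarrow> shop_state \<Rightarrow> bool" where
  "successor S s t \<longleftrightarrow> is_state S s \<and>
     (\<exists>j\<in>{1..njobs S}.
        (\<exists>i\<in>rem s j. load S s i < cap S i \<and>
           t = \<lparr>loc = (loc s)(j := i), rem = (rem s)(j := rem s j - {i})\<rparr>) \<or>
        (rem s j = {} \<and> loc s j \<noteq> nmachines S + 1 \<and>
           t = \<lparr>loc = (loc s)(j := nmachines S + 1), rem = rem s\<rparr>))"

definition deadlock :: "open_shop \<Rightarrow> shop_state \<Rightarrow> bool" where
  "deadlock S s \<longleftrightarrow> is_state S s \<and> \<not> is_final S s \<and> \<not> (\<exists>t. successor S s t)"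

definition reachable_deadlock :: "open_shop \<Rightarrow> bool" where
  "reachable_deadlock S \<longleftrightarrow> (\<exists>s. (successor S)\<^sup>*\<^sup>* (initial_state S) s \<and> deadlock S s)"

definition unit_capacity_systems :: "open_shop set" where
  "unit_capacity_systems = {S. open_shop_system S \<and> (\<forall>i\<in>{1..nmachines S}. cap S i = 1)}"

lemma is_state_initial:
  assumes "open_shop_system S"
  shows "is_state S (initial_state S)"
proof -
  have "load S (initial_state S) i = 0" if "i \<in> {1..nmachines S}" for i
    using that by (auto simp: load_def initial_state_def)
  moreover have "0 \<notin> needs S j" if "j \<in> {1..njobs S}" for j
    using assms that by (fastforce simp: open_shop_system_def)
  ultimately show ?thesis
    by (auto simp: is_state_def initial_state_def)
qed

section \<open>Encoding of systems as words\<close>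

text \<open>
  Symbols: \<open>1\<close> and \<open>2\<close> are the bits zero and one, \<open>3\<close> ends the capacity of a machine
  and \<open>4\<close> ends the description of a job. A system is written as the list of the capacities of
  its machines (in binary, least significant bit first), followed by one row per job, namely the
  characteristic vector of its machine set. Hence \<open>m\<close>, \<open>n\<close>, the capacities and the machine
  sets can all be read off, and the length is \<open>m + n * (m + 1)\<close> plus the bit lengths of the
  capacities.
\<close>

definition bit_symbol :: "bool \<Rightarrow> nat" where
  "bit_symbol b = (if b then 2 else 1)"

fun binary :: "nat \<Rightarrow> nat list" where
  "binary k = (if k = 0 then [] else bit_symbol (odd k) # binary (k div 2))"

declare binary.simps [simp del]

definition encode :: "open_shop \<Rightarrow> nat list" where
  "encode S =
     concat (map (\<lambda>i. binary (cap S i) @ [3]) [1..<Suc (nmachines S)]) @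
     concat (map (\<lambda>j. map (\<lambda>i. bit_symbol (i \<in> needs S j)) [1..<Suc (nmachines S)] @ [4])
       [1..<Suc (njobs S)])"

section \<open>Deterministic multi-tape Turing machines\<close>

text \<open>
  States and tape symbols are the numbers below \<open>nstates\<close> and \<open>nsymbols\<close>; \<open>0\<close> is the start state
  and also the blank symbol. Tapes are infinite in both directions. The transition function takes
  the state and the scanned symbols (one per tape) to the new state and, for each tape, the symbol
  to be written and the displacement of the head.
\<close>

record tm =
  ntapes :: nat
  nstates :: nat
  nsymbols :: nat
  accept :: nat
  reject :: nat
  trans :: "nat \<Rightarrow> nat list \<Rightarrow> nat \<times> (nat \<times> int) list"

definition wf_tm :: "tm \<Rightarrow> bool" where
  "wf_tm M \<longleftrightarrow>
     0 < ntapes M \<and> 0 < nstates M \<and> 0 < nsymbols M \<and>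
     accept M < nstates M \<and> reject M < nstates M \<and> accept M \<noteq> reject M \<and>
     (\<forall>q<nstates M. \<forall>xs. length xs = ntapes M \<and> set xs \<subseteq> {..<nsymbols M} \<longrightarrow>
        (case trans M q xs of (q', acts) \<Rightarrow>
           q' < nstates M \<and> length acts = ntapes M \<and>
           set acts \<subseteq> {..<nsymbols M} \<times> {-1, 0, 1}))"

type_synonym tape = "(int \<Rightarrow> nat) \<times> int"
type_synonym config = "nat \<times> tape list"

definition scan :: "tape \<Rightarrow> nat" where
  "scan = (\<lambda>(c, h). c h)"

definition act :: "nat \<times> int \<Rightarrow> tape \<Rightarrow> tape" where
  "act = (\<lambda>(a, d) (c, h). (c(h := a), h + d))"

definition step :: "tm \<Rightarrow> config \<Rightarrow> config" where
  "step M = (\<lambda>(q, ts).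
     if q = accept M \<or> q = reject M then (q, ts)
     else (case trans M q (map scan ts) of (q', acts) \<Rightarrow> (q', map2 act acts ts)))"

definition blank_tape :: tape where
  "blank_tape = ((\<lambda>_. 0), 0)"

definition input_tape :: "nat list \<Rightarrow> tape" where
  "input_tape w = ((\<lambda>z. if 0 \<le> z \<and> nat z < length w then w ! nat z else 0), 0)"

definition start_config :: "tm \<Rightarrow> nat list \<Rightarrow> config" where
  "start_config M w = (0, input_tape w # replicate (ntapes M - 1) blank_tape)"

section \<open>Solvability in polynomial time\<close>

text \<open>
  A decision problem is given by a set \<open>I\<close> of instances, an encoding \<open>enc\<close> of instances as words
  over non-blank symbols, and a predicate \<open>Q\<close> singling out the yes-instances.
\<close>

definition poly_time_solvable :: "'i set \<Rightarrow> ('i \<Rightarrow> nat list) \<Rightarrow> ('i \<Rightarrow> bool) \<Rightarrow> bool" where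
  "poly_time_solvable I enc Q \<longleftrightarrow>
     (\<exists>M. \<exists>p :: nat poly. wf_tm M \<and>
        (\<forall>x\<in>I. set (enc x) \<subseteq> {1..<nsymbols M} \<and>
           (\<exists>t \<le> poly p (length (enc x)).
              fst ((step M ^^ t) (start_config M (enc x))) = (if Q x then accept M else reject M))))"

end

theory Submission
  imports Defs
begin

text \<open>
  A unit capacity system can reach a deadlock iff the bipartite graph of jobs and machines has a
  cycle. In a deadlock, the jobs on occupied machines are as many as these machines and each of
  them is adjacent to at least two of the machines, which leaves too many edges for a forest.
  Conversely, the jobs of a cycle can each visit all their machines off the cycle and then occupy
  their predecessor machine on the cycle, after which each of them waits for the next one. A cycle
  exists iff repeatedly discarding machines (and, implicitly, jobs) of degree at most one does not
  exhaust the graph, and a two-tape machine carries out this pruning in quadratic time: there are at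
  most \<open>m + 1\<close> rounds, each taking time linear in the length of the input.
\<close>

section \<open>Fixpoints of pruning as a substitute for cycles\<close>

section \<open>Cores of set families\<close>

text \<open>Cycles are never formalised; a nonempty fixpoint of \<open>prune\<close> takes their
  place. Counting produces one from a deadlock, a matching \<open>g\<close> on a set
  \<open>C\<close> is extracted from one, and iterating \<open>prune\<close> from the set of all
  machines detects one. The set \<open>C\<close> may be a cycle with a tail, since blocking only
  requires that every job \<open>g i\<close> still awaits some machine of \<open>C\<close> and
  nothing else. This is why a job has to finish its machines outside \<open>C\<close> before it
  stops: one of them might be free and let it go. Unit capacity makes a single parked job fill its
  machine. For the Turing machine the obstacle is that whether a job counts in \<open>prune\<close>
  is known only at the far end of its row. Hence marks are raised provisionally on one pass and
  confirmed or discarded on the way back. All counters stop at two, the only threshold in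
  \<open>prune\<close>, so finitely many symbols and states suffice.\<close>

definition prune :: "'j set \<Rightarrow> ('j \<Rightarrow> 'i set) \<Rightarrow> 'i set \<Rightarrow> 'i set" where
  "prune J N X = {i \<in> X. 2 \<le> card {j \<in> J. i \<in> N j \<and> 2 \<le> card (N j \<inter> X)}}"

lemma prune_subset: "prune J N X \<subseteq> X"
  by (auto simp: prune_def)

lemma prune_mono:
  assumes "finite J" "finite X" "Y \<subseteq> X"
  shows "prune J N Y \<subseteq> prune J N X"
proof
  fix i assume i: "i \<in> prune J N Y"
  have "card (N j \<inter> Y) \<le> card (N j \<inter> X)" for j
    using assms by (intro card_mono) auto
  then have "{j \<in> J. i \<in> N j \<and> 2 \<le> card (N j \<inter> Y)} \<subseteq> {j \<in> J. i \<in> N j \<and> 2 \<le> card (N j \<inter> X)}"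
    by (auto intro: order_trans)
  then have "card {j \<in> J. i \<in> N j \<and> 2 \<le> card (N j \<inter> Y)} \<le> card {j \<in> J. i \<in> N j \<and> 2 \<le> card (N j \<inter> X)}"
    using assms(1) by (intro card_mono) auto
  with i assms(3) show "i \<in> prune J N X"
    by (auto simp: prune_def)
qed

lemma two_le_card_ex_other:
  assumes "2 \<le> card A"
  shows "\<exists>y \<in> A. y \<noteq> x"
proof (rule ccontr)
  assume "\<not> ?thesis"
  then have "A \<subseteq> {x}"
    by auto
  then have "card A \<le> card {x}"
    by (intro card_mono) auto
  with assms show False
    by simp
qed

text \<open>If \<open>C\<close> is not a fixpoint, drop one machine that fails the test together
  with the jobs of \<open>B\<close> containing it. There is at most one such job, so
  \<open>card C \<le> card B\<close> persists, and the other jobs keep their whole intersection with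
  \<open>C\<close>. The set cannot run empty: some job remains in \<open>B\<close> and forces two
  machines in \<open>C\<close>.\<close>

lemma ex_prune_fixpoint:
  assumes "finite J" "finite C" "B \<subseteq> J" "C \<noteq> {}" "card C \<le> card B"
    and "\<And>j. j \<in> B \<Longrightarrow> 2 \<le> card (N j \<inter> C)"
  shows "\<exists>Y \<subseteq> C. Y \<noteq> {} \<and> prune J N Y = Y"
  using assms(2-)
proof (induction C arbitrary: B rule: finite_psubset_induct)
  case (psubset C)
  have fB: "finite B"
    using psubset.prems(1) assms(1) by (rule finite_subset)
  show ?case
  proof (cases "prune J N C = C")
    case False
    then obtain i where i: "i \<in> C" and small: "card {j \<in> J. i \<in> N j \<and> 2 \<le> card (N j \<inter> C)} \<le> 1"
      by (force simp: prune_def)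
    define D where "D = {j \<in> B. i \<in> N j}"
    have "card D \<le> card {j \<in> J. i \<in> N j \<and> 2 \<le> card (N j \<inter> C)}"
      using psubset.prems assms(1) by (intro card_mono) (auto simp: D_def)
    then have D: "card D \<le> 1" "D \<subseteq> B"
      using small by (auto simp: D_def)
    obtain j where "j \<in> B"
      using psubset.prems(2,3) psubset.hyps by fastforce
    then have "2 \<le> card (N j \<inter> C)"
      using psubset.prems(4) by blast
    also have "\<dots> \<le> card C"
      using psubset.hyps by (intro card_mono) auto
    finally have C2: "2 \<le> card C" .
    have "card (C - {i}) = card C - 1"
      using i by simp
    moreover have "card (B - D) = card B - card D"
      using D fB by (meson card_Diff_subset finite_subset)
    ultimately have le: "card (C - {i}) \<le> card (B - D)"
      using D psubset.prems(3) by linarith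
    have ne: "C - {i} \<noteq> {}"
      using two_le_card_ex_other[OF C2, of i] by blast
    have deg: "2 \<le> card (N j \<inter> (C - {i}))" if "j \<in> B - D" for j
    proof -
      have "N j \<inter> (C - {i}) = N j \<inter> C"
        using that by (auto simp: D_def)
      then show ?thesis
        using psubset.prems(4) that by auto
    qed
    have "\<exists>Y \<subseteq> C - {i}. Y \<noteq> {} \<and> prune J N Y = Y"
      using psubset.IH[of "C - {i}" "B - D"] i ne le deg psubset.prems(1) by blast
    then show ?thesis
      by blast
  qed (use psubset.prems in blast)
qed

lemma two_le_cardI:
  assumes "finite A" "x \<in> A" "y \<in> A" "x \<noteq> y"
  shows "2 \<le> card A"
  using card_mono[of A "{x, y}"] assms by simp

text \<open>
  A walk in the incidence graph that never turns back must repeat a vertex. Stopping at the first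
  repetition gives a cycle, possibly with a tail, and along it every element can be matched to
  the set that the walk visits next.
\<close>

lemma matching_of_prune_fixpoint:
  assumes "finite Y" "Y \<noteq> {}" "prune J N Y = Y"
  shows "\<exists>C g. C \<subseteq> Y \<and> C \<noteq> {} \<and> inj_on g C \<and> g ` C \<subseteq> J \<and>
    (\<forall>i \<in> C. i \<in> N (g i) \<and> 2 \<le> card (N (g i) \<inter> C))"
proof -
  \<comment> \<open>The walk is chosen as a sequence of incidence edges, so a single dependent
    choice yields both its elements \<open>a k\<close> and its sets \<open>b k\<close>.\<close>
  define E where "E = (\<lambda>(i, j). i \<in> Y \<and> j \<in> J \<and> i \<in> N j \<and> 2 \<le> card (N j \<inter> Y))"
  have deg: "2 \<le> card {j \<in> J. i \<in> N j \<and> 2 \<le> card (N j \<inter> Y)}" if "i \<in> Y" for i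
    using that assms(3) by (auto simp: prune_def)
  have next_edge: "\<exists>e'. E e' \<and> fst e' \<noteq> fst e \<and> snd e' \<noteq> snd e \<and> fst e' \<in> N (snd e)"
    if "E e" for e
  proof -
    obtain i j where e: "e = (i, j)"
      by (cases e)
    have "2 \<le> card (N j \<inter> Y)"
      using that unfolding e E_def by simp
    then obtain i' where i': "i' \<in> N j \<inter> Y" "i' \<noteq> i"
      by (meson two_le_card_ex_other)
    then obtain j' where "j' \<in> J" "i' \<in> N j'" "2 \<le> card (N j' \<inter> Y)" "j' \<noteq> j"
      using two_le_card_ex_other[OF deg[of i'], of j] by auto
    then show ?thesis
      using i' e by (intro exI[of _ "(i', j')"]) (auto simp: E_def)
  qed
  have "\<exists>e. E e"
  proof -
    obtain i where "i \<in> Y"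
      using assms(2) by blast
    then show ?thesis
      using two_le_card_ex_other[OF deg[of i], of undefined] by (auto simp: E_def)
  qed
  then obtain f where f: "\<And>k. E (f k)"
    and step: "\<And>k. fst (f (Suc k)) \<noteq> fst (f k) \<and> snd (f (Suc k)) \<noteq> snd (f k) \<and>
      fst (f (Suc k)) \<in> N (snd (f k))"
    using dependent_nat_choice[of "\<lambda>_. E"
        "\<lambda>_ e e'. fst e' \<noteq> fst e \<and> snd e' \<noteq> snd e \<and> fst e' \<in> N (snd e)"] next_edge
    by (metis (no_types, lifting))
  define a where "a = fst \<circ> f"
  define b where "b = snd \<circ> f"
  have a: "a k \<in> Y" "a k \<in> N (b k)" "a (Suc k) \<in> N (b k)" "a (Suc k) \<noteq> a k" for k
    using f[of k] step[of k] by (auto simp: a_def b_def E_def split: prod.splits)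
  have b: "b k \<in> J" "b (Suc k) \<noteq> b k" for k
    using f[of k] step[of k] by (auto simp: a_def b_def E_def split: prod.splits)
  \<comment> \<open>Both kinds of repetition lead to a set \<open>K\<close> of times. Matching
    \<open>a k\<close> with \<open>b k\<close> then works as soon as each \<open>b k\<close>
    contains a second element visited during \<open>K\<close>.\<close>
  have build: ?thesis
    if K: "finite K" "K \<noteq> {}" and inj: "inj_on a K" "inj_on b K"
      and nxt: "\<And>k. k \<in> K \<Longrightarrow> \<exists>k' \<in> K. a k' \<in> N (b k) \<and> a k' \<noteq> a k" for K
  proof (intro exI conjI ballI)
    let ?g = "b \<circ> inv_into K a"
    show "a ` K \<subseteq> Y" "a ` K \<noteq> {}"
      using a K by auto
    show "inj_on ?g (a ` K)"
      using inj by (intro comp_inj_on inj_on_inv_into) (auto simp: inv_into_into inj_on_def)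
    show "?g ` a ` K \<subseteq> J"
      using b by auto
    fix i assume "i \<in> a ` K"
    then obtain k where k: "k \<in> K" "i = a k"
      by blast
    then have g: "?g i = b k"
      using inj by simp
    then show "i \<in> N (?g i)"
      using a k by simp
    obtain k' where "k' \<in> K" "a k' \<in> N (b k)" "a k' \<noteq> a k"
      using nxt k by blast
    then show "2 \<le> card (N (?g i) \<inter> a ` K)"
      using a k K unfolding g by (intro two_le_cardI[of _ "a k" "a k'"]) auto
  qed
  define P where "P = (\<lambda>k. \<exists>l < k. a l = a k \<or> b l = b k)"
  have "\<exists>k. P k"
  proof (rule ccontr)
    assume "\<not> ?thesis"
    then have "inj a"
      unfolding P_def by (metis injI linorder_neqE_nat)
    moreover have "range a \<subseteq> Y"
      using a by auto
    ultimately show False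
      using assms(1) by (meson finite_imageD finite_subset infinite_UNIV_nat)
  qed
  define k where "k = (LEAST k. P k)"
  have "P k"
    unfolding k_def using \<open>\<exists>k. P k\<close> by (rule LeastI_ex)
  have notP: "\<not> P y" if "y < k" for y
    using not_less_Least[of y P] that by (simp add: k_def)
  have inj: "inj_on a {..<k}" "inj_on b {..<k}"
    using notP by (auto simp: P_def intro!: linorder_inj_onI')
  show ?thesis
  proof (cases "\<exists>l < k. a l = a k")
    case True
    \<comment> \<open>An element recurs: all times before \<open>k\<close> serve, tail included,
      because the last set \<open>b (k - 1)\<close> contains \<open>a k = a l\<close>.\<close>
    then obtain l where l: "l < k" "a l = a k"
      by blast
    show ?thesis
    proof (rule build[of "{..<k}"])
      fix x assume x: "x \<in> {..<k}"
      show "\<exists>k' \<in> {..<k}. a k' \<in> N (b x) \<and> a k' \<noteq> a x"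
      proof (cases "Suc x = k")
        case True
        then have "a l \<in> N (b x) \<and> a l \<noteq> a x"
          using a[of x] l by simp
        then show ?thesis
          using l by blast
      next
        case False
        then show ?thesis
          using a[of x] x by (intro bexI[of _ "Suc x"]) auto
      qed
    qed (use inj l in auto)
  next
    case False
    \<comment> \<open>Only a set recurs: the times after \<open>l\<close> up to \<open>k\<close>
      serve. Time \<open>l\<close> is dropped since \<open>b l = b k\<close>, and this set contains
      both \<open>a k\<close> and \<open>a (Suc l)\<close>.\<close>
    then obtain l where l: "l < k" "b l = b k"
      using \<open>P k\<close> by (auto simp: P_def)
    have "Suc l \<noteq> k"
      using b(2)[of l] l by auto
    have ia: "inj_on a {l<..k}"
    proof (rule inj_onI)
      fix x y assume xy: "x \<in> {l<..k}" "y \<in> {l<..k}" "a x = a y"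
      show "x = y"
        using False xy inj(1) unfolding inj_on_def
        by (metis greaterThanAtMost_iff lessThan_iff nat_less_le)
    qed
    have ib: "inj_on b {l<..k}"
    proof (rule inj_onI)
      fix x y assume xy: "x \<in> {l<..k}" "y \<in> {l<..k}" "b x = b y"
      have "b z \<noteq> b k" if "l < z" "z < k" for z
        using inj(2) l that unfolding inj_on_def by (metis lessThan_iff less_irrefl)
      then show "x = y"
        using xy inj(2) unfolding inj_on_def
        by (metis greaterThanAtMost_iff lessThan_iff nat_less_le)
    qed
    show ?thesis
    proof (rule build[of "{l<..k}"])
      fix x assume x: "x \<in> {l<..k}"
      show "\<exists>k' \<in> {l<..k}. a k' \<in> N (b x) \<and> a k' \<noteq> a x"
      proof (cases "x = k")
        case True
        have "a (Suc l) \<in> N (b k)"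
          using a[of l] l by simp
        moreover have "a (Suc l) \<noteq> a k"
          using ia \<open>Suc l \<noteq> k\<close> l unfolding inj_on_def by auto
        ultimately show ?thesis
          using True l by (intro bexI[of _ "Suc l"]) auto
      next
        case False
        then show ?thesis
          using a[of x] x by (intro bexI[of _ "Suc x"]) auto
      qed
    qed (use ia ib l in auto)
  qed
qed

section \<open>Equivalence of reachable deadlocks and nonempty fixpoints\<close>

section \<open>Reachable deadlocks\<close>

lemma load_loc_upd:
  shows "load S \<lparr>loc = (loc s)(j := i), rem = r\<rparr> k \<le> (if k = i then Suc (load S s k) else load S s k)"
proof (cases "k = i")
  case True
  have "{x \<in> {1..njobs S}. ((loc s)(j := i)) x = i} \<subseteq> insert j {x \<in> {1..njobs S}. loc s x = i}"
    by auto
  then have "card {x \<in> {1..njobs S}. ((loc s)(j := i)) x = i} \<le> card (insert j {x \<in> {1..njobs S}. loc s x = i})"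
    by (intro card_mono) auto
  also have "\<dots> \<le> Suc (card {x \<in> {1..njobs S}. loc s x = i})"
    by (simp add: card_insert_if)
  finally show ?thesis
    using True by (simp add: load_def)
next
  case False
  then have "{x \<in> {1..njobs S}. ((loc s)(j := i)) x = k} \<subseteq> {x \<in> {1..njobs S}. loc s x = k}"
    by auto
  then have "card {x \<in> {1..njobs S}. ((loc s)(j := i)) x = k} \<le> card {x \<in> {1..njobs S}. loc s x = k}"
    by (intro card_mono) auto
  then show ?thesis
    using False by (simp add: load_def)
qed

definition proper_state :: "open_shop \<Rightarrow> shop_state \<Rightarrow> bool" where
  "proper_state S s \<longleftrightarrow> is_state S s \<and>
     (\<forall>j \<in> {1..njobs S}. (loc s j = nmachines S + 1 \<longrightarrow> rem s j = {}) \<and>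
        (loc s j \<in> {1..nmachines S} \<longrightarrow> loc s j \<in> needs S j))"

lemma proper_state_initial: "open_shop_system S \<Longrightarrow> proper_state S (initial_state S)"
  using is_state_initial[of S] by (auto simp: proper_state_def initial_state_def)

lemma proper_state_successor:
  assumes S: "open_shop_system S" and s: "proper_state S s" and st: "successor S s t"
  shows "proper_state S t"
proof -
  have ist: "is_state S s"
    using s by (simp add: proper_state_def)
  obtain j where j: "j \<in> {1..njobs S}" and cases:
    "(\<exists>i\<in>rem s j. load S s i < cap S i \<and>
           t = \<lparr>loc = (loc s)(j := i), rem = (rem s)(j := rem s j - {i})\<rparr>) \<or>
        (rem s j = {} \<and> loc s j \<noteq> nmachines S + 1 \<and>
           t = \<lparr>loc = (loc s)(j := nmachines S + 1), rem = rem s\<rparr>)"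
    using st unfolding successor_def by blast
  from cases show ?thesis
  proof (elim disjE bexE conjE)
    fix i assume i: "i \<in> rem s j" and ld: "load S s i < cap S i"
      and t: "t = \<lparr>loc = (loc s)(j := i), rem = (rem s)(j := rem s j - {i})\<rparr>"
    have iN: "i \<in> needs S j" "i \<in> {1..nmachines S}"
      using i ist j S unfolding is_state_def open_shop_system_def by blast+
    have "load S t k \<le> cap S k" if "k \<in> {1..nmachines S}" for k
    proof -
      have "load S t k \<le> (if k = i then Suc (load S s k) else load S s k)"
        unfolding t using load_loc_upd by blast
      also have "\<dots> \<le> cap S k"
        using ld ist that by (auto simp: is_state_def)
      finally show ?thesis .
    qed
    moreover have "\<forall>k\<in>{1..njobs S}. loc t k \<le> nmachines S + 1 \<and> rem t k \<subseteq> needs S k - {loc t k}"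
      using ist iN by (auto simp: t is_state_def)
    ultimately show ?thesis
      using s iN by (auto simp: proper_state_def is_state_def t)
  next
    assume r: "rem s j = {}" and t: "t = \<lparr>loc = (loc s)(j := nmachines S + 1), rem = rem s\<rparr>"
    have "load S t k \<le> cap S k" if "k \<in> {1..nmachines S}" for k
    proof -
      have "load S t k \<le> (if k = nmachines S + 1 then Suc (load S s k) else load S s k)"
        unfolding t using load_loc_upd by blast
      also have "\<dots> \<le> cap S k"
        using ist that by (auto simp: is_state_def)
      finally show ?thesis .
    qed
    moreover have "\<forall>k\<in>{1..njobs S}. loc t k \<le> nmachines S + 1 \<and> rem t k \<subseteq> needs S k - {loc t k}"
      using ist r by (auto simp: t is_state_def)
    ultimately show ?thesis
      using s r by (auto simp: proper_state_def is_state_def t)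
  qed
qed

lemma proper_state_reachable:
  assumes "open_shop_system S" "(successor S)\<^sup>*\<^sup>* s t" "proper_state S s"
  shows "proper_state S t"
  using assms(2,3) by induction (auto intro: proper_state_successor[OF assms(1)])

lemma prune_fixpoint_of_deadlock:
  assumes S: "S \<in> unit_capacity_systems" and "reachable_deadlock S"
  shows "\<exists>Y \<subseteq> {1..nmachines S}. Y \<noteq> {} \<and> prune {1..njobs S} (needs S) Y = Y"
proof -
  have sys: "open_shop_system S" and cap: "\<And>i. i \<in> {1..nmachines S} \<Longrightarrow> cap S i = 1"
    using S by (auto simp: unit_capacity_systems_def)
  obtain s where "(successor S)\<^sup>*\<^sup>* (initial_state S) s" and dl: "deadlock S s"
    using assms(2) by (auto simp: reachable_deadlock_def)
  then have pst: "proper_state S s"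
    using proper_state_reachable proper_state_initial sys by blast
  then have st: "is_state S s"
    by (simp add: proper_state_def)
  let ?J = "{1..njobs S}" and ?M = "{1..nmachines S}"
  have stuck: "\<not> successor S s t" for t
    using dl by (auto simp: deadlock_def)
  have pending: "rem s j \<noteq> {}" if "j \<in> ?J" "loc s j \<noteq> nmachines S + 1" for j
    using stuck[of "\<lparr>loc = (loc s)(j := nmachines S + 1), rem = rem s\<rparr>"] that st
    unfolding successor_def by blast
  \<comment> \<open>An awaited machine in a deadlock is full, and as its capacity is positive
    somebody sits on it.\<close>
  have occ: "\<exists>k \<in> ?J. loc s k = i" if "j \<in> ?J" "i \<in> rem s j" for i j
  proof -
    have "i \<in> ?M"
      using that st sys unfolding is_state_def open_shop_system_def by blast
    moreover have "\<not> load S s i < cap S i"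
      using stuck[of "\<lparr>loc = (loc s)(j := i), rem = (rem s)(j := rem s j - {i})\<rparr>"] that st
      unfolding successor_def by blast
    ultimately have "card {k \<in> ?J. loc s k = i} \<noteq> 0"
      using cap by (auto simp: load_def)
    then show ?thesis
      by (metis (mono_tags, lifting) card.empty empty_Collect_eq)
  qed
  have rem_M: "rem s j \<subseteq> ?M" if "j \<in> ?J" for j
    using that st sys unfolding is_state_def open_shop_system_def by blast
  define B where "B = {j \<in> ?J. loc s j \<in> ?M}"
  define C where "C = loc s ` B"
  have rem_C: "rem s j \<subseteq> C" if "j \<in> ?J" for j
    using occ[OF that] rem_M[OF that] by (fastforce simp: C_def B_def)
  \<comment> \<open>Some job is unfinished; it must await a machine, and awaited machines are
    occupied, so \<open>C\<close> is not empty.\<close>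
  obtain j0 where j0: "j0 \<in> ?J" "\<not> (loc s j0 = nmachines S + 1 \<and> rem s j0 = {})"
    using dl unfolding deadlock_def is_final_def by blast
  then have "rem s j0 \<noteq> {}"
    using pending pst unfolding proper_state_def by blast
  then have "C \<noteq> {}"
    using rem_C j0 by blast
  moreover have "finite B"
    by (simp add: B_def)
  then have "card C \<le> card B" "finite C"
    by (auto simp: C_def card_image_le)
  moreover have "2 \<le> card (needs S j \<inter> C)" if "j \<in> B" for j
  proof -
    have j: "j \<in> ?J" "loc s j \<in> ?M"
      using that by (auto simp: B_def)
    then obtain i where i: "i \<in> rem s j"
      using pending by fastforce
    have "i \<in> needs S j" "i \<noteq> loc s j"
      using i j st unfolding is_state_def by blast+
    moreover have "loc s j \<in> needs S j"
      using j pst by (auto simp: proper_state_def)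
    ultimately show ?thesis
      using rem_C[of j] i j that \<open>finite C\<close> by (intro two_le_cardI[of _ i "loc s j"]) (auto simp: C_def)
  qed
  moreover have "B \<subseteq> ?J" "C \<subseteq> ?M"
    by (auto simp: B_def C_def)
  ultimately obtain Y where "Y \<subseteq> C" "Y \<noteq> {}" "prune ?J (needs S) Y = Y"
    using ex_prune_fixpoint[of ?J C B "needs S"] by auto
  then show ?thesis
    using \<open>C \<subseteq> ?M\<close> by blast
qed

text \<open>Termination measure: one move per pending machine, plus one to leave.\<close>

definition work :: "open_shop \<Rightarrow> shop_state \<Rightarrow> nat" where
  "work S s = (\<Sum>j\<in>{1..njobs S}. card (rem s j) + (if loc s j = nmachines S + 1 then 0 else 1))"

lemma work_successor:
  assumes S: "open_shop_system S" and s: "proper_state S s" and "successor S s t"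
  shows "work S t < work S s"
proof -
  have st: "is_state S s"
    using assms(3) by (simp add: successor_def)
  obtain j where j: "j \<in> {1..njobs S}" and cases:
    "(\<exists>i\<in>rem s j. load S s i < cap S i \<and>
           t = \<lparr>loc = (loc s)(j := i), rem = (rem s)(j := rem s j - {i})\<rparr>) \<or>
        (rem s j = {} \<and> loc s j \<noteq> nmachines S + 1 \<and>
           t = \<lparr>loc = (loc s)(j := nmachines S + 1), rem = rem s\<rparr>)"
    using assms(3) unfolding successor_def by blast
  let ?w = "\<lambda>s j. card (rem s j) + (if loc s j = nmachines S + 1 then 0 else 1)"
  have "rem s j \<subseteq> {1..nmachines S}"
    using j st S unfolding is_state_def open_shop_system_def by blast
  then have fin: "finite (rem s j)"
    by (rule finite_subset) simp
  have same: "?w t k = ?w s k" if "k \<noteq> j" for k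
    using cases that by auto
  have "?w t j < ?w s j"
    using cases
  proof (elim disjE bexE conjE)
    fix i assume i: "i \<in> rem s j"
      and t: "t = \<lparr>loc = (loc s)(j := i), rem = (rem s)(j := rem s j - {i})\<rparr>"
    \<comment> \<open>A job that has left has nothing pending in a proper state, so the exit summand
      cannot go back from 0 to 1.\<close>
    have "loc s j \<noteq> nmachines S + 1"
      using s i j by (auto simp: proper_state_def)
    moreover have "card (rem s j - {i}) < card (rem s j)"
      using fin i by (rule card_Diff1_less)
    ultimately show ?thesis
      by (auto simp: t)
  qed simp
  then show ?thesis
    unfolding work_def using j same
    by (intro sum_strict_mono_ex1) (metis finite_atLeastAtMost less_imp_le order_refl)+
qed

text \<open>
  The jobs \<open>g ` C\<close> wait for each other, so they never move again, whatever the other jobs do.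
\<close>

definition blocked :: "open_shop \<Rightarrow> nat set \<Rightarrow> (nat \<Rightarrow> nat) \<Rightarrow> shop_state \<Rightarrow> bool" where
  "blocked S C g s \<longleftrightarrow>
     (\<forall>i \<in> C. g i \<in> {1..njobs S} \<and> loc s (g i) = i \<and> rem s (g i) \<noteq> {} \<and> rem s (g i) \<subseteq> C)"

lemma full_of_occupied:
  assumes "j \<in> {1..njobs S}" "cap S (loc s j) = 1"
  shows "\<not> load S s (loc s j) < cap S (loc s j)"
proof -
  have "card {j} \<le> load S s (loc s j)"
    unfolding load_def using assms by (intro card_mono) auto
  then show ?thesis
    using assms by simp
qed

text \<open>Each machine of \<open>C\<close> is filled by its own \<open>g i\<close>, and the jobs
  \<open>g i\<close> await only machines of \<open>C\<close>; hence the job that moves is none of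
  them.\<close>

lemma blocked_successor:
  assumes cap: "\<And>i. i \<in> C \<Longrightarrow> cap S i = 1" and bl: "blocked S C g s" and "successor S s t"
  shows "blocked S C g t"
proof -
  obtain j where j: "j \<in> {1..njobs S}" and cases:
    "(\<exists>i\<in>rem s j. load S s i < cap S i \<and>
           t = \<lparr>loc = (loc s)(j := i), rem = (rem s)(j := rem s j - {i})\<rparr>) \<or>
        (rem s j = {} \<and> loc s j \<noteq> nmachines S + 1 \<and>
           t = \<lparr>loc = (loc s)(j := nmachines S + 1), rem = rem s\<rparr>)"
    using assms(3) unfolding successor_def by blast
  have full: "\<not> load S s i < cap S i" if "i \<in> C" for i
    using full_of_occupied[of "g i" S s] bl cap that by (auto simp: blocked_def)
  have "j \<notin> g ` C"
  proof
    assume "j \<in> g ` C"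
    then obtain k where "k \<in> C" "j = g k"
      by blast
    then have "rem s j \<noteq> {}" "rem s j \<subseteq> C"
      using bl by (auto simp: blocked_def)
    then show False
      using cases full by blast
  qed
  moreover have "loc t k = loc s k \<and> rem t k = rem s k" if "k \<noteq> j" for k
    using cases that by auto
  ultimately have "loc t (g i) = loc s (g i) \<and> rem t (g i) = rem s (g i)" if "i \<in> C" for i
    using that by (metis imageI)
  then show ?thesis
    using bl by (simp add: blocked_def)
qed

text \<open>Let the remaining jobs move for as long as they can. Since \<open>work\<close> decreases
  this stops, and the blocked jobs keep the last state from being final.\<close>

lemma deadlock_of_blocked:
  assumes S: "open_shop_system S" and cap: "\<And>i. i \<in> C \<Longrightarrow> cap S i = 1" and "C \<noteq> {}"
    and "blocked S C g s" "proper_state S s"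
  shows "\<exists>t. (successor S)\<^sup>*\<^sup>* s t \<and> deadlock S t"
  using assms(4,5)
proof (induction "work S s" arbitrary: s rule: less_induct)
  case less
  show ?case
  proof (cases "\<exists>t. successor S s t")
    case True
    then obtain t where t: "successor S s t"
      by blast
    have "\<exists>u. (successor S)\<^sup>*\<^sup>* t u \<and> deadlock S u"
      using less work_successor[OF S _ t] blocked_successor[OF cap _ t] proper_state_successor[OF S _ t]
      by blast
    then show ?thesis
      using t by (meson converse_rtranclp_into_rtranclp)
  next
    case False
    obtain i where "i \<in> C"
      using \<open>C \<noteq> {}\<close> by blast
    then have "\<not> is_final S s"
      using less.prems by (auto simp: blocked_def is_final_def)
    then have "deadlock S s"
      using False less.prems by (auto simp: deadlock_def proper_state_def)
    then show ?thesis
      by blast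
  qed
qed

lemma move_job:
  assumes S: "S \<in> unit_capacity_systems" and s: "proper_state S s" and j: "j \<in> {1..njobs S}"
    and i: "i \<in> rem s j" and free: "\<And>k. k \<in> {1..njobs S} \<Longrightarrow> loc s k \<noteq> i"
  shows "successor S s \<lparr>loc = (loc s)(j := i), rem = (rem s)(j := rem s j - {i})\<rparr>"
proof -
  have st: "is_state S s"
    using s by (simp add: proper_state_def)
  have "i \<in> {1..nmachines S}"
    using S i j st unfolding is_state_def open_shop_system_def unit_capacity_systems_def by blast
  then have "cap S i = 1"
    using S by (auto simp: unit_capacity_systems_def)
  moreover have "load S s i = 0"
    using free by (auto simp: load_def)
  ultimately have "load S s i < cap S i"
    by simp
  then show ?thesis
    unfolding successor_def using st j i by blast
qed

text \<open>The order of the visits is irrelevant, so the last location \<open>l\<close> is left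
  unspecified. It only has to avoid \<open>C\<close>, so that the job does not occupy a machine on
  which another one is to be parked.\<close>

lemma move_job_through:
  assumes S: "S \<in> unit_capacity_systems" and s: "proper_state S s" and j: "j \<in> {1..njobs S}"
    and D: "finite D" "D \<subseteq> rem s j" "D \<inter> C = {}" and out: "loc s j \<notin> C"
    and free: "\<And>i k. i \<in> D \<Longrightarrow> k \<in> {1..njobs S} \<Longrightarrow> loc s k \<noteq> i"
  shows "\<exists>l. l \<notin> C \<and> l \<in> insert (loc s j) D \<and>
    (successor S)\<^sup>*\<^sup>* s \<lparr>loc = (loc s)(j := l), rem = (rem s)(j := rem s j - D)\<rparr>"
  using D free
proof (induction D rule: finite_induct)
  case empty
  have "s = \<lparr>loc = (loc s)(j := loc s j), rem = (rem s)(j := rem s j - {})\<rparr>"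
    by simp
  then show ?case
    using out by (metis insertI1 rtranclp.rtrancl_refl)
next
  case (insert i D)
  then obtain l where l: "l \<notin> C" "l \<in> insert (loc s j) D"
    and reach: "(successor S)\<^sup>*\<^sup>* s \<lparr>loc = (loc s)(j := l), rem = (rem s)(j := rem s j - D)\<rparr>"
    by (metis insert_subset insertCI Int_insert_left_if0 Int_insert_left_if1 insert_not_empty)
  let ?t = "\<lparr>loc = (loc s)(j := l), rem = (rem s)(j := rem s j - D)\<rparr>"
  have "proper_state S ?t"
    using proper_state_reachable reach s S by (auto simp: unit_capacity_systems_def)
  moreover have "i \<in> rem ?t j"
    using insert by auto
  moreover have "loc ?t k \<noteq> i" if "k \<in> {1..njobs S}" for k
    using insert.prems(3)[of i] insert.hyps l j that by auto
  ultimately have "successor S ?t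
    \<lparr>loc = (loc ?t)(j := i), rem = (rem ?t)(j := rem ?t j - {i})\<rparr>"
    by (rule move_job[OF S _ j])
  moreover have "\<lparr>loc = (loc ?t)(j := i), rem = (rem ?t)(j := rem ?t j - {i})\<rparr> =
    \<lparr>loc = (loc s)(j := i), rem = (rem s)(j := rem s j - insert i D)\<rparr>"
    by (simp flip: Diff_insert)
  ultimately have "(successor S)\<^sup>*\<^sup>* s \<lparr>loc = (loc s)(j := i), rem = (rem s)(j := rem s j - insert i D)\<rparr>"
    using reach by (metis rtranclp.rtrancl_into_rtrancl)
  then show ?case
    using insert.prems(2) by blast
qed

text \<open>
  The jobs of the matching enter one after another: each first visits all its machines outside \<open>C\<close>
  and then occupies the machine it is matched to.
\<close>

lemma blocked_reachable:
  assumes S: "S \<in> unit_capacity_systems" and C: "C \<subseteq> {1..nmachines S}"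
    and g: "inj_on g C" "g ` C \<subseteq> {1..njobs S}" "\<And>i. i \<in> C \<Longrightarrow> i \<in> needs S (g i)"
    and deg: "\<And>i. i \<in> C \<Longrightarrow> 2 \<le> card (needs S (g i) \<inter> C)"
  shows "\<exists>s. (successor S)\<^sup>*\<^sup>* (initial_state S) s \<and> blocked S C g s"
proof -
  have sys: "open_shop_system S"
    using S by (simp add: unit_capacity_systems_def)
  have fC: "finite C"
    using C finite_subset by blast
  have "\<exists>s. (successor S)\<^sup>*\<^sup>* (initial_state S) s \<and>
      (\<forall>i \<in> A. loc s (g i) = i \<and> rem s (g i) = needs S (g i) \<inter> C - {i}) \<and>
      (\<forall>j. j \<notin> g ` A \<longrightarrow> loc s j = 0 \<and> rem s j = needs S j)" if "A \<subseteq> C" for A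
    using finite_subset[OF that fC] that
  proof (induction A rule: finite_induct)
    case empty
    show ?case
      by (intro exI[of _ "initial_state S"]) (auto simp: initial_state_def)
  next
    case (insert i A)
    then obtain s where reach: "(successor S)\<^sup>*\<^sup>* (initial_state S) s"
      and A: "\<And>i. i \<in> A \<Longrightarrow> loc s (g i) = i \<and> rem s (g i) = needs S (g i) \<inter> C - {i}"
      and nA: "\<And>j. j \<notin> g ` A \<Longrightarrow> loc s j = 0 \<and> rem s j = needs S j"
      by auto
    define j where "j = g i"
    have "j \<in> {1..njobs S}"
      using insert.prems g(2) unfolding j_def by blast
    moreover have "j \<notin> g ` A"
      using insert.prems insert.hyps(2) g(1) unfolding j_def
      by (metis inj_on_image_mem_iff insert_subset)
    ultimately have j: "j \<in> {1..njobs S}" "j \<notin> g ` A" .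
    have pst: "proper_state S s"
      using proper_state_reachable[OF sys reach] proper_state_initial[OF sys] by blast
    have needs: "needs S j \<subseteq> {1..nmachines S}"
      using sys j by (auto simp: open_shop_system_def)
    \<comment> \<open>Every job is at \<open>0\<close> or on a machine of \<open>A\<close>, so the
      machines outside \<open>C\<close> and the target \<open>i\<close> are all empty.\<close>
    have locA: "loc s k \<in> insert 0 A" for k
      using A nA by (cases "k \<in> g ` A") auto
    have "0 \<notin> C"
      using C by auto
    have D: "finite (needs S j - C)" "needs S j - C \<subseteq> rem s j"
      using needs nA[OF j(2)] by (auto intro: finite_subset)
    have D': "loc s k \<noteq> x" if "x \<in> needs S j - C" for k x
      using locA[of k] needs that insert.prems by auto
    obtain l where l: "l \<notin> C" "l \<in> insert (loc s j) (needs S j - C)"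
      and reach2: "(successor S)\<^sup>*\<^sup>* s \<lparr>loc = (loc s)(j := l), rem = (rem s)(j := rem s j - (needs S j - C))\<rparr>"
      using move_job_through[OF S pst j(1) D, of C] D' nA[OF j(2)] \<open>0 \<notin> C\<close> by auto
    let ?t = "\<lparr>loc = (loc s)(j := l), rem = (rem s)(j := rem s j - (needs S j - C))\<rparr>"
    let ?u = "\<lparr>loc = (loc ?t)(j := i), rem = (rem ?t)(j := rem ?t j - {i})\<rparr>"
    have prop_t: "proper_state S ?t"
      using proper_state_reachable[OF sys reach2 pst] .
    have remt: "rem ?t j = needs S j \<inter> C"
      using nA[OF j(2)] by auto
    have "i \<in> rem ?t j"
      using remt g insert.prems by (auto simp: j_def)
    moreover have "loc ?t k \<noteq> i" for k
      using locA[of k] l insert \<open>0 \<notin> C\<close> by auto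
    ultimately have "successor S ?t ?u"
      using move_job[OF S prop_t j(1)] by blast
    then have "(successor S)\<^sup>*\<^sup>* (initial_state S) ?u"
      using reach reach2 by (meson rtranclp.rtrancl_into_rtrancl rtranclp_trans)
    moreover have "loc ?u (g x) = x \<and> rem ?u (g x) = needs S (g x) \<inter> C - {x}" if "x \<in> insert i A" for x
    proof (cases "x = i")
      case True
      then show ?thesis
        using remt by (simp add: j_def)
    next
      case False
      then have "x \<in> A" "g x \<noteq> j"
        using that j by auto
      then show ?thesis
        using A by simp
    qed
    moreover have "loc ?u x = 0 \<and> rem ?u x = needs S x" if "x \<notin> g ` insert i A" for x
      using that nA by (auto simp: j_def)
    ultimately show ?case
      by blast
  qed
  from this[OF order_refl] obtain s where reach: "(successor S)\<^sup>*\<^sup>* (initial_state S) s"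
    and s: "\<And>i. i \<in> C \<Longrightarrow> loc s (g i) = i \<and> rem s (g i) = needs S (g i) \<inter> C - {i}"
    by blast
  have "needs S (g i) \<inter> C - {i} \<noteq> {}" if "i \<in> C" for i
    using two_le_card_ex_other[OF deg[OF that], of i] by auto
  then have "blocked S C g s"
    using s g by (auto simp: blocked_def)
  then show ?thesis
    using reach by blast
qed

theorem reachable_deadlock_iff_prune_fixpoint:
  assumes S: "S \<in> unit_capacity_systems"
  shows "reachable_deadlock S \<longleftrightarrow>
    (\<exists>Y \<subseteq> {1..nmachines S}. Y \<noteq> {} \<and> prune {1..njobs S} (needs S) Y = Y)"
proof
  assume "\<exists>Y \<subseteq> {1..nmachines S}. Y \<noteq> {} \<and> prune {1..njobs S} (needs S) Y = Y"
  then obtain Y where Y: "Y \<subseteq> {1..nmachines S}" "Y \<noteq> {}" "prune {1..njobs S} (needs S) Y = Y"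
    by blast
  then have "finite Y"
    using finite_subset by blast
  then obtain C g where C: "C \<subseteq> Y" "C \<noteq> {}" and g: "inj_on g C" "g ` C \<subseteq> {1..njobs S}"
    "\<And>i. i \<in> C \<Longrightarrow> i \<in> needs S (g i)" "\<And>i. i \<in> C \<Longrightarrow> 2 \<le> card (needs S (g i) \<inter> C)"
    using matching_of_prune_fixpoint[OF _ Y(2,3)] by blast
  have CM: "C \<subseteq> {1..nmachines S}"
    using C Y by blast
  obtain s where s: "(successor S)\<^sup>*\<^sup>* (initial_state S) s" "blocked S C g s"
    using blocked_reachable[OF S CM g] by blast
  have sys: "open_shop_system S" and cap: "\<And>i. i \<in> C \<Longrightarrow> cap S i = 1"
    using S CM by (auto simp: unit_capacity_systems_def)
  have "proper_state S s"
    using proper_state_reachable[OF sys s(1)] proper_state_initial[OF sys] by blast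
  then obtain t where "(successor S)\<^sup>*\<^sup>* s t" "deadlock S t"
    using deadlock_of_blocked[OF sys cap C(2) s(2)] by blast
  then show "reachable_deadlock S"
    using s(1) unfolding reachable_deadlock_def by (meson rtranclp_trans)
qed (rule prune_fixpoint_of_deadlock[OF S])

section \<open>Transition table, time-bounded runs and tape words\<close>

section \<open>The Turing machine\<close>

text \<open>
  The first tape keeps the input. The second tape has one cell per machine \<open>1, \<dots>, m\<close>: \<open>1\<close> marks a
  machine that has been pruned, \<open>2 + min c 2\<close> one that is still present and is needed by \<open>c\<close> of the
  jobs read so far in the current round that need at least two present machines. In states \<open>1\<close>,
  \<open>2\<close>, \<open>3\<close> both heads run leftwards through the row of a job, the state counting its present
  machines up to two, and their marks are raised by \<open>3\<close>. As the second head returns, state \<open>4\<close>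
  discards the raised marks and state \<open>5\<close> turns them into increments. After the last row, states
  \<open>6\<close> to \<open>9\<close> prune all machines with mark less than \<open>4\<close>, recording whether some machine was pruned
  (odd states) and whether some machine survived (states \<open>8\<close> and \<open>9\<close>). States \<open>10\<close> and \<open>11\<close> bring
  both heads back to their right ends for the next round.
\<close>

definition commit :: "nat \<Rightarrow> nat \<Rightarrow> nat" where
  "commit q b = (if b < 5 then b else if q = 4 then b - 3 else min (b - 2) 4)"

text \<open>The result lists the new state, the move of the first head, the symbol written on the
  second tape and the move of its head. State \<open>0\<close> sets up the second tape, writing one
  mark \<open>2\<close> per symbol \<open>3\<close>, that is, per machine. Raised marks are
  \<open>5\<close> to \<open>7\<close>, disjoint from the plain marks \<open>1\<close> to
  \<open>4\<close>; hence \<open>min (b - 2) 4\<close> in \<open>commit\<close> is the original mark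
  plus one, capped.\<close>

definition delta :: "nat \<Rightarrow> nat \<Rightarrow> nat \<Rightarrow> nat \<times> int \<times> nat \<times> int" where
  "delta q a b =
    (if q = 0 then
       (if a = 0 then (4, -1, b, 0) else if a = 3 then (0, 1, 2, 1) else (0, 1, b, 0))
     else if q \<le> 3 then
       (if a = 1 \<or> a = 2 then
          (if a = 2 \<and> 2 \<le> b \<and> b \<le> 4 then (min (q + 1) 3, -1, b + 3, -1) else (q, -1, b, -1))
        else (if q = 3 then 5 else 4, 0, b, 1))
     else if q \<le> 5 then
       (if b \<noteq> 0 then (q, 0, commit q b, 1)
        else if a = 4 then (1, -1, 0, -1) else (6, 0, 0, -1))
     else if q \<le> 9 then
       (if b = 0 then
          (if odd q then (10, 0, 0, 1) else (if q = 8 then 12 else 13, 0, 0, 0))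
        else if b = 1 then (q, 0, 1, -1)
        else if b = 4 then (if q < 8 then q + 2 else q, 0, 2, -1)
        else (if even q then q + 1 else q, 0, 1, -1))
     else if q = 10 then (if b \<noteq> 0 then (10, 0, b, 1) else (11, 0, 0, 0))
     else (if a \<noteq> 0 then (11, 1, b, 0) else (4, -1, b, 0)))"

definition shop_tm :: tm where
  "shop_tm = \<lparr>ntapes = 2, nstates = 14, nsymbols = 8, accept = 12, reject = 13,
     trans = (\<lambda>q xs. case delta q (xs ! 0) (xs ! 1) of (q', d, b, e) \<Rightarrow> (q', [(xs ! 0, d), (b, e)]))\<rparr>"

lemma delta_range:
  assumes "q < 14" "a < 8" "b < 8" "delta q a b = (q', d, b', e)"
  shows "q' < 14 \<and> d \<in> {-1, 0, 1} \<and> b' < 8 \<and> e \<in> {-1, 0, 1}"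
  using assms unfolding delta_def commit_def by (auto split: if_splits)

lemma wf_shop_tm: "wf_tm shop_tm"
proof -
  have "case trans shop_tm q xs of (q', acts) \<Rightarrow>
      q' < 14 \<and> length acts = 2 \<and> set acts \<subseteq> {..<8} \<times> {-1, 0, 1}"
    if "q < 14" "length xs = 2" "set xs \<subseteq> {..<8}" for q xs
  proof -
    obtain q' d b e where eq: "delta q (xs ! 0) (xs ! 1) = (q', d, b, e)"
      by (metis prod_cases4)
    have "xs ! 0 < 8" "xs ! 1 < 8"
      using that(2,3) by (auto simp: numeral_2_eq_2 length_Suc_conv)
    then show ?thesis
      using delta_range[OF that(1) _ _ eq] eq by (simp add: shop_tm_def)
  qed
  then show ?thesis
    by (simp add: wf_tm_def shop_tm_def)
qed

text \<open>A bound instead of an exact step count lets estimates be rounded up while runs are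
  chained.\<close>

definition runs :: "nat \<Rightarrow> config \<Rightarrow> config \<Rightarrow> bool" where
  "runs t c c' \<longleftrightarrow> (\<exists>k \<le> t. (step shop_tm ^^ k) c = c')"

lemma runs_refl: "runs t c c"
  by (auto simp: runs_def intro: exI[of _ 0])

lemma runs_step: "step shop_tm c = c' \<Longrightarrow> runs 1 c c'"
  by (auto simp: runs_def intro!: exI[of _ 1])

lemma runs_trans:
  assumes "runs s a b" "runs t b c" "s + t \<le> r"
  shows "runs r a c"
proof -
  obtain k l where "k \<le> s" "(step shop_tm ^^ k) a = b" "l \<le> t" "(step shop_tm ^^ l) b = c"
    using assms(1,2) by (auto simp: runs_def)
  then have "(step shop_tm ^^ (l + k)) a = c" "l + k \<le> r"
    using assms(3) by (auto simp: funpow_add)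
  then show ?thesis
    by (auto simp: runs_def)
qed

lemma step_shop_tm:
  assumes "delta q (c h) (v i) = (q', d, b, e)" "q < 12"
  shows "step shop_tm (q, [(c, h), (v, i)]) = (q', [(c, h + d), (v(i := b), i + e)])"
  using assms by (simp add: step_def shop_tm_def scan_def act_def)

text \<open>Cell \<open>i\<close> of a word sits at position \<open>i - 1\<close>, so that cells are numbered like machines.\<close>

definition cells :: "nat \<Rightarrow> (nat \<Rightarrow> nat) \<Rightarrow> int \<Rightarrow> nat" where
  "cells k u z = (if 0 \<le> z \<and> z < int k then u (nat z + 1) else 0)"

lemma cells_at: "cells k u (int i - 1) = (if 1 \<le> i \<and> i \<le> k then u i else 0)"
  by (auto simp: cells_def nat_diff_distrib)

lemma cells_cong: "(\<And>i. 1 \<le> i \<Longrightarrow> i \<le> k \<Longrightarrow> u i = v i) \<Longrightarrow> cells k u = cells k v"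
  by (rule ext) (auto simp: cells_def)

lemma cells_upd: "1 \<le> i \<Longrightarrow> i \<le> k \<Longrightarrow> (cells k u)(int i - 1 := x) = cells k (u(i := x))"
  by (rule ext) (auto simp: cells_def)

lemma cells_upd_blank: "i = 0 \<or> k < i \<Longrightarrow> (cells k u)(int i - 1 := 0) = cells k u"
  by (rule ext) (auto simp: cells_def)

lemma cells_upd_new: "(cells k u)(int (Suc k) - 1 := x) = cells (Suc k) (u(Suc k := x))"
  by (rule ext) (auto simp: cells_def)

section \<open>Cell-by-cell content of an encoded system\<close>

section \<open>Reading the input\<close>

lemma block_index_less:
  fixes n :: nat
  assumes "k < n" "i < d"
  shows "k * d + i < n * d"
proof -
  have "k * d + i < Suc k * d"
    using assms by simp
  also have "\<dots> \<le> n * d"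
    using assms by (intro mult_le_mono1) simp
  finally show ?thesis .
qed

lemma length_concat_map_upt:
  assumes "\<And>j. 1 \<le> j \<Longrightarrow> j \<le> n \<Longrightarrow> length (f j) = d"
  shows "length (concat (map f [1..<Suc n])) = n * d"
  using assms by (induction n) auto

lemma concat_map_upt_nth:
  assumes "\<And>j. 1 \<le> j \<Longrightarrow> j \<le> n \<Longrightarrow> length (f j) = d" and "k < n" "i < d"
  shows "concat (map f [1..<Suc n]) ! (k * d + i) = f (Suc k) ! i"
  using assms(1,2)
proof (induction n)
  case (Suc n)
  have len: "length (concat (map f [1..<Suc n])) = n * d"
    using Suc.prems(1) by (intro length_concat_map_upt) simp
  have split: "concat (map f [1..<Suc (Suc n)]) = concat (map f [1..<Suc n]) @ f (Suc n)"
    by simp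
  show ?case
  proof (cases "k = n")
    case True
    then show ?thesis
      unfolding split nth_append len by simp
  next
    case False
    then have "k < n"
      using Suc.prems(2) by simp
    then have "k * d + i < n * d"
      using \<open>i < d\<close> by (rule block_index_less)
    then show ?thesis
      using Suc.IH Suc.prems(1) \<open>k < n\<close> unfolding split nth_append len by simp
  qed
qed simp

locale unit_shop =
  fixes S :: open_shop
  assumes unit: "S \<in> unit_capacity_systems"
begin

abbreviation m :: nat where "m \<equiv> nmachines S"
abbreviation n :: nat where "n \<equiv> njobs S"
abbreviation N :: "nat \<Rightarrow> nat set" where "N \<equiv> needs S"
abbreviation len :: nat where "len \<equiv> length (encode S)"

text \<open>Each capacity 1 is written \<open>[2, 3]\<close>, whence \<open>2 * m\<close>; a row has
  \<open>m\<close> bits and the end symbol. \<open>rowend 0\<close> is the last cell of the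
  capacities, so bit \<open>i\<close> of row \<open>Suc k\<close> is in cell
  \<open>rowend k + i\<close>.\<close>

definition rowend :: "nat \<Rightarrow> nat" where
  "rowend k = 2 * m + k * Suc m"

definition sym :: "nat \<Rightarrow> nat" where
  "sym z = (if 1 \<le> z \<and> z \<le> len then encode S ! (z - 1) else 0)"

abbreviation caps :: "nat list" where
  "caps \<equiv> concat (map (\<lambda>i. [2, 3]) [1..<Suc m])"

abbreviation row :: "nat \<Rightarrow> nat list" where
  "row j \<equiv> map (\<lambda>i. bit_symbol (i \<in> N j)) [1..<Suc m] @ [4]"

abbreviation rows :: "nat list" where
  "rows \<equiv> concat (map row [1..<Suc n])"

lemma encode_eq: "encode S = caps @ rows"
proof -
  have "binary (Suc 0) = [2]"
    by (simp add: binary.simps bit_symbol_def)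
  then have "binary (cap S i) @ [3] = [2, 3]" if "i \<in> set [1..<Suc m]" for i
    using unit that by (auto simp: unit_capacity_systems_def)
  then have "map (\<lambda>i. binary (cap S i) @ [3]) [1..<Suc m] = map (\<lambda>i. [2, 3]) [1..<Suc m]"
    by (intro map_cong) auto
  then show ?thesis
    unfolding encode_def by (simp only:)
qed

lemma len_caps: "length caps = 2 * m"
  using length_concat_map_upt[of m "\<lambda>_. [2, 3 :: nat]" 2] by simp

lemma len_rows: "length rows = n * Suc m"
  by (rule length_concat_map_upt) simp

lemma len_eq: "len = rowend n"
  by (simp only: encode_eq length_append len_caps len_rows rowend_def)

lemma sym_caps: "k < m \<Longrightarrow> i < 2 \<Longrightarrow> sym (2 * k + i + 1) = [2, 3] ! i"
  using concat_map_upt_nth[of m "\<lambda>_. [2, 3 :: nat]" 2 k i] len_caps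
  by (simp add: sym_def encode_eq nth_append mult.commute del: upt_Suc)

lemma sym_rows:
  assumes "k < n" "i < Suc m"
  shows "sym (rowend k + i + 1) = row (Suc k) ! i"
proof -
  have nth: "rows ! (k * Suc m + i) = row (Suc k) ! i"
    using assms by (intro concat_map_upt_nth) simp_all
  have "k * Suc m + i < n * Suc m"
    using assms by (rule block_index_less)
  then have "rowend k + i < len"
    by (simp only: len_eq rowend_def)
  moreover have "encode S ! (rowend k + i) = rows ! (k * Suc m + i)"
    by (simp only: encode_eq nth_append len_caps rowend_def) (simp add: add.assoc del: upt_Suc)
  ultimately show ?thesis
    using nth by (simp add: sym_def)
qed

lemma sym_bit: "k < n \<Longrightarrow> 1 \<le> i \<Longrightarrow> i \<le> m \<Longrightarrow> sym (rowend k + i) = (if i \<in> N (Suc k) then 2 else 1)"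
  using sym_rows[of k "i - 1"] by (simp add: nth_append bit_symbol_def del: upt_Suc)

lemma sym_rowend: "k < n \<Longrightarrow> sym (rowend (Suc k)) = 4"
  using sym_rows[of k m] by (simp add: nth_append rowend_def algebra_simps del: upt_Suc)

text \<open>The cell before the first row is the last \<open>3\<close>, or a blank if
  \<open>m = 0\<close>. Not being a bit, it stops the leftward scan; not being \<open>4\<close>, it
  tells the machine that no row is left.\<close>

lemma sym_rowend_0: "sym (rowend 0) \<noteq> 1" "sym (rowend 0) \<noteq> 2" "sym (rowend 0) \<noteq> 4"
proof -
  have "sym (rowend 0) \<in> {0, 3}"
  proof (cases m)
    case 0
    then show ?thesis
      by (simp add: rowend_def sym_def)
  next
    case (Suc k)
    then show ?thesis
      using sym_caps[of k 1] by (simp add: rowend_def)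
  qed
  then show "sym (rowend 0) \<noteq> 1" "sym (rowend 0) \<noteq> 2" "sym (rowend 0) \<noteq> 4"
    by auto
qed

lemma sym_rowend_not_bit: "k \<le> n \<Longrightarrow> sym (rowend k) \<noteq> 1 \<and> sym (rowend k) \<noteq> 2"
  using sym_rowend_0 sym_rowend by (cases k) auto

lemma set_rows: "set rows \<subseteq> {1, 2, 4}"
  by (auto simp: bit_symbol_def)

lemma set_encode: "set (encode S) \<subseteq> {1..<8}"
proof -
  have "set caps \<subseteq> {2, 3}"
    by auto
  then have "set (encode S) \<subseteq> {2, 3} \<union> {1, 2, 4}"
    using set_rows unfolding encode_eq set_append by blast
  then show ?thesis
    by auto
qed

lemma sym_nonblank: "1 \<le> z \<Longrightarrow> z \<le> len \<Longrightarrow> sym z \<noteq> 0"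
proof -
  assume z: "1 \<le> z" "z \<le> len"
  then have "encode S ! (z - 1) \<in> set (encode S)"
    by (intro nth_mem) linarith
  then have "encode S ! (z - 1) \<in> {1..<8}"
    using set_encode by blast
  then show ?thesis
    using z by (simp add: sym_def)
qed

text \<open>State \<open>0\<close> adds a mark at every \<open>3\<close>, so the rows must not
  contain any.\<close>

lemma sym_after_caps:
  assumes "2 * m < z" "z \<le> len"
  shows "sym z \<noteq> 3"
proof -
  have "sym z = rows ! (z - 1 - 2 * m)"
    using assms by (simp only: sym_def encode_eq nth_append len_caps) auto
  moreover have "z - 1 - 2 * m < length rows"
    using assms len_eq unfolding len_rows rowend_def by linarith
  then have "rows ! (z - 1 - 2 * m) \<in> {1, 2, 4}"
    by (rule subsetD[OF set_rows nth_mem])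
  ultimately show ?thesis
    by auto
qed

lemma sym_blank: "sym (Suc len) = 0"
  by (simp add: sym_def)

section \<open>Simulation of rows, rounds and the whole computation\<close>

section \<open>Correctness of the machine\<close>

definition inp :: "int \<Rightarrow> nat" where
  "inp = cells len (\<lambda>z. encode S ! (z - 1))"

lemma inp_at: "inp (int z - 1) = sym z"
  by (simp add: inp_def cells_at sym_def)

lemma start_config_eq: "start_config shop_tm (encode S) = (0, [(inp, 0), (cells 0 u, 0)])"
  by (auto simp: start_config_def shop_tm_def input_tape_def blank_tape_def inp_def cells_def fun_eq_iff)

definition cfg :: "nat \<Rightarrow> nat \<Rightarrow> nat \<Rightarrow> (nat \<Rightarrow> nat) \<Rightarrow> config" where
  "cfg q z i u = (q, [(inp, int z - 1), (cells m u, int i - 1)])"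

lemma cfg_cong: "(\<And>x. 1 \<le> x \<Longrightarrow> x \<le> m \<Longrightarrow> u x = v x) \<Longrightarrow> cfg q z i u = cfg q z i v"
  by (simp add: cfg_def cong: cells_cong)

text \<open>Stating the moves as equations over \<open>int\<close> keeps natural cell numbers
  without truncated subtraction when a head moves left.\<close>

lemma step_cell:
  assumes "delta q (sym z) (u i) = (q', d, b, e)" "q < 12" "1 \<le> i" "i \<le> m"
    "int z' = int z + d" "int i' = int i + e"
  shows "runs 1 (cfg q z i u) (cfg q' z' i' (u(i := b)))"
  using step_shop_tm[of q inp "int z - 1" "cells m u" "int i - 1" q' d b e] assms
  by (intro runs_step) (simp add: cfg_def inp_at cells_at cells_upd)

lemma step_blank:
  assumes "delta q (sym z) 0 = (q', d, 0, e)" "q < 12" "i = 0 \<or> m < i"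
    "int z' = int z + d" "int i' = int i + e"
  shows "runs 1 (cfg q z i u) (cfg q' z' i' u)"
  using step_shop_tm[of q inp "int z - 1" "cells m u" "int i - 1" q' d 0 e] assms
  by (intro runs_step) (auto simp: cfg_def inp_at cells_at cells_upd_blank)

subsection \<open>Rows\<close>

text \<open>The machines already counted when the heads, coming from the right, stand on cell
  \<open>i\<close>; a mark of at least \<open>2\<close> means present.\<close>

definition hits :: "nat \<Rightarrow> (nat \<Rightarrow> nat) \<Rightarrow> nat \<Rightarrow> nat set" where
  "hits k u i = {x \<in> N (Suc k). i < x \<and> x \<le> m \<and> 2 \<le> u x}"

lemma finite_hits: "finite (hits k u i)"
  by (rule finite_subset[of _ "{..m}"]) (auto simp: hits_def)

definition raise :: "nat \<Rightarrow> (nat \<Rightarrow> nat) \<Rightarrow> nat \<Rightarrow> nat \<Rightarrow> nat" where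
  "raise k u i = (\<lambda>x. if x \<in> hits k u i then u x + 3 else u x)"

lemma runs_row_left:
  assumes "k < n" and u: "\<And>x. 1 \<le> x \<Longrightarrow> x \<le> m \<Longrightarrow> u x \<le> 4" and "i \<le> m"
  shows "runs (m - i) (cfg 1 (rowend k + m) m u)
    (cfg (Suc (min 2 (card (hits k u i)))) (rowend k + i) i (raise k u i))"
  using \<open>i \<le> m\<close>
proof (induction rule: inc_induct)
  case base
  have "hits k u m = {}"
    by (auto simp: hits_def)
  then show ?case
    by (simp add: raise_def runs_refl)
next
  case (step i)
  let ?v = "raise k u (Suc i)" and ?q = "Suc (min 2 (card (hits k u (Suc i))))"
  \<comment> \<open>The cell under the head has not been raised yet.\<close>
  have v: "?v (Suc i) = u (Suc i)" "u (Suc i) \<le> 4"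
    using u[of "Suc i"] step by (auto simp: raise_def hits_def)
  have sym: "sym (rowend k + Suc i) = (if Suc i \<in> N (Suc k) then 2 else 1)"
    using sym_bit[of k "Suc i"] assms(1) step by simp
  have "runs 1 (cfg ?q (rowend k + Suc i) (Suc i) ?v)
    (cfg (Suc (min 2 (card (hits k u i)))) (rowend k + i) i (raise k u i))"
  proof (cases "Suc i \<in> N (Suc k) \<and> 2 \<le> u (Suc i)")
    case True
    have ins: "hits k u i = insert (Suc i) (hits k u (Suc i))"
      using True step by (auto simp: hits_def Suc_lessI Suc_le_eq)
    have "Suc i \<notin> hits k u (Suc i)"
      by (simp add: hits_def)
    then have card: "card (hits k u i) = Suc (card (hits k u (Suc i)))"
      using finite_hits by (simp add: ins)
    have upd: "raise k u i = ?v(Suc i := u (Suc i) + 3)"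
      using ins by (auto simp: raise_def fun_eq_iff)
    have "delta ?q (sym (rowend k + Suc i)) (?v (Suc i)) =
        (Suc (min 2 (card (hits k u i))), -1, u (Suc i) + 3, -1)"
      unfolding sym v(1) using True v(2) card by (auto simp: delta_def)
    then show ?thesis
      unfolding upd by (rule step_cell) (use step.hyps in auto)
  next
    case False
    have lt: "i < x \<longleftrightarrow> x = Suc i \<or> Suc i < x" for x
      by auto
    have same: "hits k u i = hits k u (Suc i)"
      using False unfolding hits_def lt by auto
    have "delta ?q (sym (rowend k + Suc i)) (?v (Suc i)) = (?q, -1, ?v (Suc i), -1)"
      unfolding sym v(1) using False by (auto simp: delta_def)
    from step_cell[where u = ?v and i = "Suc i", OF this, of "rowend k + i" i]
    have "runs 1 (cfg ?q (rowend k + Suc i) (Suc i) ?v) (cfg ?q (rowend k + i) i ?v)"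
      using step.hyps by (simp only: fun_upd_triv)
    then show ?thesis
      by (simp only: raise_def same)
  qed
  then show ?case
    using step by (intro runs_trans[OF step.IH]) auto
qed

lemma runs_row_right:
  assumes q: "q \<in> {4, 5}" and v: "\<And>x. 1 \<le> x \<Longrightarrow> x \<le> m \<Longrightarrow> v x \<noteq> 0" and "i \<le> m"
  shows "runs i (cfg q z 1 v) (cfg q z (Suc i) (\<lambda>x. if x \<le> i then commit q (v x) else v x))"
  using \<open>i \<le> m\<close>
proof (induction i)
  case 0
  have "cfg q z 1 v = cfg q z (Suc 0) (\<lambda>x. if x \<le> 0 then commit q (v x) else v x)"
    unfolding One_nat_def by (rule cfg_cong) auto
  then show ?case
    by (simp add: runs_refl)
next
  case (Suc i)
  let ?v = "\<lambda>i x. if x \<le> i then commit q (v x) else v x"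
  have "delta q (sym z) (?v i (Suc i)) = (q, 0, commit q (v (Suc i)), 1)"
    using q v[of "Suc i"] Suc.prems by (auto simp: delta_def)
  from step_cell[where u = "?v i" and i = "Suc i", OF this, of z "Suc (Suc i)"]
  have "runs 1 (cfg q z (Suc i) (?v i)) (cfg q z (Suc (Suc i)) ((?v i)(Suc i := commit q (v (Suc i)))))"
    using q Suc.prems by auto
  moreover have "(?v i)(Suc i := commit q (v (Suc i))) = ?v (Suc i)"
    by (auto simp: fun_eq_iff le_Suc_eq)
  ultimately show ?case
    using Suc by (intro runs_trans[OF Suc.IH]) auto
qed

definition row_update :: "nat \<Rightarrow> (nat \<Rightarrow> nat) \<Rightarrow> nat \<Rightarrow> nat" where
  "row_update k u = (\<lambda>x. if x \<in> hits k u 0 \<and> 2 \<le> card (hits k u 0) then min (u x + 1) 4 else u x)"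

text \<open>Two sweeps over \<open>m\<close> marks, one step to enter the row over its end symbol
  and one step to turn round make \<open>2 * m + 2\<close>.\<close>

lemma runs_row:
  assumes k: "k < n" and u: "\<And>x. 1 \<le> x \<Longrightarrow> x \<le> m \<Longrightarrow> u x \<in> {1..4}" and q: "q \<in> {4, 5}"
  shows "\<exists>q' \<in> {4, 5}. runs (2 * m + 2) (cfg q (rowend (Suc k)) (Suc m) u)
    (cfg q' (rowend k) (Suc m) (row_update k u))"
proof -
  define p where "p = Suc (min 2 (card (hits k u 0)))"
  define q' :: nat where "q' = (if p = 3 then 5 else 4)"
  have q': "q' \<in> {4, 5}"
    by (simp add: q'_def)
  have 1: "runs 1 (cfg q (rowend (Suc k)) (Suc m) u) (cfg 1 (rowend k + m) m u)"
    using q sym_rowend[OF k] by (intro step_blank[where d = "-1" and e = "-1"]) (auto simp: delta_def rowend_def)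
  have 2: "runs m (cfg 1 (rowend k + m) m u) (cfg p (rowend k) 0 (raise k u 0))"
    using runs_row_left[OF k, of u 0] u by (simp add: p_def)
  have 3: "runs 1 (cfg p (rowend k) 0 (raise k u 0)) (cfg q' (rowend k) 1 (raise k u 0))"
    using k sym_rowend_not_bit[of k]
    by (intro step_blank[where d = 0 and e = 1]) (auto simp: delta_def p_def q'_def)
  have "raise k u 0 x \<noteq> 0" if "1 \<le> x" "x \<le> m" for x
    using u[OF that] by (auto simp: raise_def)
  then have 4: "runs m (cfg q' (rowend k) 1 (raise k u 0))
      (cfg q' (rowend k) (Suc m) (\<lambda>x. if x \<le> m then commit q' (raise k u 0 x) else raise k u 0 x))"
    by (intro runs_row_right q') auto
  have 5: "cfg q' (rowend k) (Suc m) (\<lambda>x. if x \<le> m then commit q' (raise k u 0 x) else raise k u 0 x) =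
    cfg q' (rowend k) (Suc m) (row_update k u)"
  proof (rule cfg_cong)
    fix x assume x: "1 \<le> x" "x \<le> m"
    \<comment> \<open>Raised marks are therefore at least \<open>5\<close> and all others at most
      \<open>4\<close>, so \<open>commit\<close> recognises exactly the hits.\<close>
    have "2 \<le> u x" if "x \<in> hits k u 0"
      using that by (simp add: hits_def)
    then show "(if x \<le> m then commit q' (raise k u 0 x) else raise k u 0 x) = row_update k u x"
      using u[OF x] x by (auto simp: commit_def raise_def row_update_def q'_def p_def)
  qed
  have "runs (2 * m + 2) (cfg q (rowend (Suc k)) (Suc m) u) (cfg q' (rowend k) (Suc m) (row_update k u))"
    using runs_trans[OF runs_trans[OF runs_trans[OF 1 2 order_refl] 3 order_refl] 4] 5 by simp
  then show ?thesis
    using q' by blast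
qed

text \<open>Second tape once the rows after \<open>k\<close> have been read; rows are read from the
  last to the first.\<close>

definition marks :: "nat set \<Rightarrow> nat \<Rightarrow> nat \<Rightarrow> nat" where
  "marks X k = (\<lambda>x. if x \<in> X
     then 2 + min 2 (card {j \<in> {k<..n}. x \<in> N j \<and> 2 \<le> card (N j \<inter> X)}) else 1)"

lemma marks_range: "marks X k x \<in> {1..4}"
  by (auto simp: marks_def)

lemma marks_end: "marks X n x = (if x \<in> X then 2 else 1)"
  by (simp add: marks_def)

text \<open>Counting never takes a mark from below \<open>2\<close> to above or back, so presence in
  \<open>X\<close> stays legible during the whole round. Every job is thus tested against the same
  \<open>X\<close>, as \<open>prune\<close> demands.\<close>

lemma row_update_marks:
  assumes "X \<subseteq> {1..m}" "k < n"
  shows "row_update k (marks X (Suc k)) = marks X k"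
proof
  fix x
  let ?J = "\<lambda>k. {j \<in> {k<..n}. x \<in> N j \<and> 2 \<le> card (N j \<inter> X)}"
  have two: "2 \<le> marks X (Suc k) y \<longleftrightarrow> y \<in> X" for y
    by (simp add: marks_def)
  have hits: "hits k (marks X (Suc k)) 0 = N (Suc k) \<inter> X"
    using assms(1) two by (auto simp: hits_def)
  have "{k<..n} = insert (Suc k) {Suc k<..n}"
    using assms(2) by auto
  then have J: "?J k = (if x \<in> N (Suc k) \<and> 2 \<le> card (N (Suc k) \<inter> X)
      then insert (Suc k) (?J (Suc k)) else ?J (Suc k))"
    by auto
  have "card (?J k) = (if x \<in> N (Suc k) \<and> 2 \<le> card (N (Suc k) \<inter> X)
      then Suc (card (?J (Suc k))) else card (?J (Suc k)))"
    unfolding J by simp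
  then show "row_update k (marks X (Suc k)) x = marks X k x"
    unfolding row_update_def hits by (auto simp: marks_def)
qed

lemma runs_rows:
  assumes X: "X \<subseteq> {1..m}" and "k \<le> n"
  shows "\<exists>q \<in> {4, 5}. runs ((n - k) * (2 * m + 2)) (cfg 4 len (Suc m) (marks X n))
    (cfg q (rowend k) (Suc m) (marks X k))"
  using \<open>k \<le> n\<close>
proof (induction rule: inc_induct)
  case base
  then show ?case
    by (auto simp: len_eq runs_refl)
next
  case (step k)
  then obtain q where q: "q \<in> {4, 5}" and run: "runs ((n - Suc k) * (2 * m + 2))
      (cfg 4 len (Suc m) (marks X n)) (cfg q (rowend (Suc k)) (Suc m) (marks X (Suc k)))"
    by blast
  obtain q' where q': "q' \<in> {4, 5}" and run': "runs (2 * m + 2)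
      (cfg q (rowend (Suc k)) (Suc m) (marks X (Suc k))) (cfg q' (rowend k) (Suc m) (marks X k))"
    using runs_row[OF _ _ q, of k "marks X (Suc k)"] marks_range row_update_marks[OF X] step by metis
  have "(n - Suc k) * (2 * m + 2) + (2 * m + 2) = Suc (n - Suc k) * (2 * m + 2)"
    by simp
  also have "\<dots> = (n - k) * (2 * m + 2)"
    using step by (simp only: Suc_diff_Suc)
  finally show ?case
    using runs_trans[OF run run'] q' by (metis order_refl)
qed

subsection \<open>Rounds\<close>

lemma runs_columns:
  assumes u: "\<And>x. 1 \<le> x \<Longrightarrow> x \<le> m \<Longrightarrow> u x \<in> {1..4}" and "i \<le> m"
  shows "runs (m - i) (cfg 6 z m u)
    (cfg (6 + (if \<exists>x \<in> {i<..m}. u x = 2 \<or> u x = 3 then 1 else 0) + (if \<exists>x \<in> {i<..m}. u x = 4 then 2 else 0))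
      z i (\<lambda>x. if i < x then (if u x = 4 then 2 else 1) else u x))"
    (is "runs _ _ (cfg (?q i) z i (?u i))")
  using \<open>i \<le> m\<close>
proof (induction rule: inc_induct)
  case base
  have "cfg 6 z m u = cfg 6 z m (?u m)"
    by (rule cfg_cong) auto
  then show ?case
    by (simp add: runs_refl)
next
  case (step i)
  have range: "{i<..m} = insert (Suc i) {Suc i<..m}"
    using step by auto
  have "u (Suc i) \<in> {1..4}"
    using u[of "Suc i"] step by simp
  then consider "u (Suc i) = 1" | "u (Suc i) = 2 \<or> u (Suc i) = 3" | "u (Suc i) = 4"
    by force
  then have "delta (?q (Suc i)) (sym z) (?u (Suc i) (Suc i)) =
      (?q i, 0, if u (Suc i) = 4 then 2 else 1, -1)"
    by cases (auto simp: delta_def range)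
  from step_cell[where u = "?u (Suc i)" and i = "Suc i", OF this, of z i] have "runs 1 (cfg (?q (Suc i)) z (Suc i) (?u (Suc i)))
      (cfg (?q i) z i ((?u (Suc i))(Suc i := if u (Suc i) = 4 then 2 else 1)))"
    using step by auto
  moreover have "(?u (Suc i))(Suc i := if u (Suc i) = 4 then 2 else 1) = ?u i"
    by (auto simp: fun_eq_iff not_less le_Suc_eq)
  ultimately show ?case
    using step by (intro runs_trans[OF step.IH]) auto
qed

abbreviation pr :: "nat set \<Rightarrow> nat set" where
  "pr \<equiv> prune {1..n} N"

lemma marks_0:
  assumes "X \<subseteq> {1..m}"
  shows "marks X 0 x = 4 \<longleftrightarrow> x \<in> pr X" "marks X 0 x = 2 \<or> marks X 0 x = 3 \<longleftrightarrow> x \<in> X - pr X"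
proof -
  define c where "c = card {j \<in> {1..n}. x \<in> N j \<and> 2 \<le> card (N j \<inter> X)}"
  have "{0<..n} = {1..n}"
    by auto
  then have "marks X 0 x = (if x \<in> X then 2 + min 2 c else 1)"
    by (simp only: marks_def c_def)
  moreover have "x \<in> pr X \<longleftrightarrow> x \<in> X \<and> 2 \<le> c"
    by (simp add: prune_def c_def)
  ultimately show "marks X 0 x = 4 \<longleftrightarrow> x \<in> pr X"
    "marks X 0 x = 2 \<or> marks X 0 x = 3 \<longleftrightarrow> x \<in> X - pr X"
    by auto
qed

lemma runs_prune:
  assumes X: "X \<subseteq> {1..m}"
  shows "runs (n * (2 * m + 2) + m + 1) (cfg 4 len (Suc m) (marks X n))
    (cfg (6 + (if pr X \<noteq> X then 1 else 0) + (if pr X \<noteq> {} then 2 else 0)) (rowend 0) 0 (marks (pr X) n))"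
proof -
  obtain q where q: "q \<in> {4, 5}" and 1: "runs (n * (2 * m + 2)) (cfg 4 len (Suc m) (marks X n))
    (cfg q (rowend 0) (Suc m) (marks X 0))"
    using runs_rows[OF X, of 0] by auto
  have 2: "runs 1 (cfg q (rowend 0) (Suc m) (marks X 0)) (cfg 6 (rowend 0) m (marks X 0))"
    using q sym_rowend_0 by (intro step_blank[where d = 0 and e = "-1"]) (auto simp: delta_def)
  have pr: "pr X \<subseteq> X"
    by (rule prune_subset)
  have ex: "(\<exists>x \<in> {0<..m}. marks X 0 x = 2 \<or> marks X 0 x = 3) \<longleftrightarrow> pr X \<noteq> X"
    "(\<exists>x \<in> {0<..m}. marks X 0 x = 4) \<longleftrightarrow> pr X \<noteq> {}"
    unfolding marks_0[OF X] using X pr by force+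
  have cfg: "cfg q z i (\<lambda>x. if 0 < x then (if marks X 0 x = 4 then 2 else 1) else marks X 0 x) =
    cfg q z i (marks (pr X) n)" for q z i
    by (rule cfg_cong) (simp add: marks_0[OF X] marks_end)
  have 3: "runs m (cfg 6 (rowend 0) m (marks X 0))
    (cfg (6 + (if pr X \<noteq> X then 1 else 0) + (if pr X \<noteq> {} then 2 else 0)) (rowend 0) 0 (marks (pr X) n))"
    using runs_columns[of "marks X 0" 0 "rowend 0"] marks_range unfolding ex cfg by simp
  show ?thesis
    by (rule runs_trans[OF runs_trans[OF 1 2 order_refl] 3]) simp
qed

lemma runs_verdict:
  assumes X: "X \<subseteq> {1..m}" and stable: "pr X = X"
  shows "runs (n * (2 * m + 2) + m + 2) (cfg 4 len (Suc m) (marks X n))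
    (cfg (if X = {} then 13 else 12) (rowend 0) 0 (marks X n))"
proof -
  have "runs 1 (cfg (6 + (if X \<noteq> X then 1 else 0) + (if X \<noteq> {} then 2 else 0)) (rowend 0) 0 (marks X n))
      (cfg (if X = {} then 13 else 12) (rowend 0) 0 (marks X n))"
    by (rule step_blank[where d = 0 and e = 0]) (auto simp: delta_def)
  then show ?thesis
    by (rule runs_trans[OF runs_prune[OF X, unfolded stable]]) simp
qed

lemma runs_return_marks:
  assumes "\<And>x. 1 \<le> x \<Longrightarrow> x \<le> m \<Longrightarrow> u x \<noteq> 0" "i \<le> m"
  shows "runs i (cfg 10 z 1 u) (cfg 10 z (Suc i) u)"
  using \<open>i \<le> m\<close>
proof (induction i)
  case (Suc i)
  have "delta 10 (sym z) (u (Suc i)) = (10, 0, u (Suc i), 1)"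
    using assms(1)[of "Suc i"] Suc.prems by (simp add: delta_def)
  from step_cell[where u = u and i = "Suc i", OF this, of z "Suc (Suc i)"] show ?case
    using Suc by (intro runs_trans[OF Suc.IH]) auto
qed (simp add: runs_refl)

lemma runs_return_input:
  assumes "1 \<le> z" "z + d \<le> Suc len"
  shows "runs d (cfg 11 z (Suc m) u) (cfg 11 (z + d) (Suc m) u)"
  using assms(2)
proof (induction d)
  case (Suc d)
  have "delta 11 (sym (z + d)) 0 = (11, 1, 0, 0)"
    using sym_nonblank[of "z + d"] assms(1) Suc.prems by (simp add: delta_def)
  from step_blank[OF this, of "Suc m" "z + Suc d" "Suc m" u] show ?case
    using Suc by (intro runs_trans[OF Suc.IH]) auto
qed (simp add: runs_refl)

lemma runs_round:
  assumes X: "X \<subseteq> {1..m}" and change: "pr X \<noteq> X"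
  shows "runs (3 * len + 5) (cfg 4 len (Suc m) (marks X n)) (cfg 4 len (Suc m) (marks (pr X) n))"
proof -
  let ?u = "marks (pr X) n"
  \<comment> \<open>Some machine was pruned. Without machines the return in state \<open>11\<close>
    would start on a blank and stop too early.\<close>
  have "1 \<le> m"
    using X change prune_subset[of "{1..n}" N X] by (cases m) auto
  then have z: "1 \<le> rowend 0" "rowend 0 \<le> len"
    by (auto simp: len_eq rowend_def)
  define q :: nat where "q = 6 + 1 + (if pr X \<noteq> {} then 2 else 0)"
  have 1: "runs (n * (2 * m + 2) + m + 1) (cfg 4 len (Suc m) (marks X n)) (cfg q (rowend 0) 0 ?u)"
    using runs_prune[OF X] change by (simp add: q_def)
  have 2: "runs 1 (cfg q (rowend 0) 0 ?u) (cfg 10 (rowend 0) 1 ?u)"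
    by (rule step_blank[where d = 0 and e = 1]) (auto simp: delta_def q_def)
  have 3: "runs m (cfg 10 (rowend 0) 1 ?u) (cfg 10 (rowend 0) (Suc m) ?u)"
    by (rule runs_return_marks) (auto simp: marks_end)
  have 4: "runs 1 (cfg 10 (rowend 0) (Suc m) ?u) (cfg 11 (rowend 0) (Suc m) ?u)"
    by (rule step_blank[where d = 0 and e = 0]) (auto simp: delta_def)
  have 5: "runs (Suc len - rowend 0) (cfg 11 (rowend 0) (Suc m) ?u) (cfg 11 (Suc len) (Suc m) ?u)"
    using runs_return_input[OF z(1), of "Suc len - rowend 0" ?u] z by simp
  have 6: "runs 1 (cfg 11 (Suc len) (Suc m) ?u) (cfg 4 len (Suc m) ?u)"
    by (rule step_blank[where d = "-1" and e = 0]) (auto simp: delta_def sym_blank)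
  \<comment> \<open>The rows cost twice their length and the return at most \<open>len + 1\<close>;
    the sum of all phases is \<open>3 * len - 4 * m + 5\<close>.\<close>
  have "n * (2 * m + 2) = 2 * (len - 2 * m)" "rowend 0 = 2 * m"
    by (simp_all add: len_eq rowend_def)
  then have "n * (2 * m + 2) + m + 1 + 1 + m + 1 + (Suc len - rowend 0) + 1 \<le> 3 * len + 5"
    using z by linarith
  then show ?thesis
    using runs_trans[OF runs_trans[OF runs_trans[OF runs_trans[OF runs_trans[OF 1 2 order_refl]
              3 order_refl] 4 order_refl] 5 order_refl] 6] by blast
qed

text \<open>Every round but the last removes a machine, which gives at most \<open>card X\<close>
  changing rounds and one for the verdict.\<close>

lemma runs_rounds:
  assumes "X \<subseteq> {1..m}"
  shows "\<exists>c. runs (Suc (card X) * (3 * len + 5)) (cfg 4 len (Suc m) (marks X n)) c \<and>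
    fst c = (if \<exists>Y \<subseteq> X. Y \<noteq> {} \<and> pr Y = Y then 12 else 13)"
  using assms
proof (induction "card X" arbitrary: X rule: less_induct)
  case less
  have fX: "finite X"
    using less.prems finite_subset by blast
  have sub: "pr X \<subseteq> X"
    by (rule prune_subset)
  show ?case
  proof (cases "pr X = X")
    case True
    have "(\<exists>Y \<subseteq> X. Y \<noteq> {} \<and> pr Y = Y) \<longleftrightarrow> X \<noteq> {}"
      using True by auto
    moreover have "n * (2 * m + 2) + m + 2 \<le> 3 * len + 5"
      by (simp add: len_eq rowend_def)
    then have "runs (Suc (card X) * (3 * len + 5)) (cfg 4 len (Suc m) (marks X n))
        (cfg (if X = {} then 13 else 12) (rowend 0) 0 (marks X n))"
      by (intro runs_trans[OF runs_verdict[OF less.prems True] runs_refl[of 0]]) simp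
    ultimately show ?thesis
      by (intro exI conjI) (assumption, simp add: cfg_def)
  next
    case False
    have card: "card (pr X) < card X"
      using False sub fX by (intro psubset_card_mono) auto
    obtain c where c: "runs (Suc (card (pr X)) * (3 * len + 5)) (cfg 4 len (Suc m) (marks (pr X) n)) c"
      "fst c = (if \<exists>Y \<subseteq> pr X. Y \<noteq> {} \<and> pr Y = Y then 12 else 13)"
      using less.hyps[OF card order_trans[OF sub less.prems]] by blast
    \<comment> \<open>By monotonicity a fixpoint inside \<open>X\<close> survives the round, so
      pruning loses no witness.\<close>
    have "Y \<subseteq> pr X \<longleftrightarrow> Y \<subseteq> X" if "pr Y = Y" for Y
      using prune_mono[of "{1..n}" X Y N] that fX sub by auto
    then have iff: "(\<exists>Y \<subseteq> pr X. Y \<noteq> {} \<and> pr Y = Y) \<longleftrightarrow> (\<exists>Y \<subseteq> X. Y \<noteq> {} \<and> pr Y = Y)"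
      by (intro ex_cong1) (simp cong: conj_cong, blast)
    have "(3 * len + 5) + Suc (card (pr X)) * (3 * len + 5) \<le> Suc (card X) * (3 * len + 5)"
      using mult_le_mono1[of "Suc (Suc (card (pr X)))" "Suc (card X)" "3 * len + 5"] card by simp
    from runs_trans[OF runs_round[OF less.prems False] c(1) this] show ?thesis
      using c(2) unfolding iff by (intro exI conjI)
  qed
qed

subsection \<open>Initialisation\<close>

text \<open>A separate form is needed because \<open>cfg\<close> presupposes all \<open>m\<close>
  marks; here the second head stands on the first blank after the \<open>k\<close> marks written so
  far.\<close>

definition init_cfg :: "nat \<Rightarrow> nat \<Rightarrow> config" where
  "init_cfg z k = (0, [(inp, int z - 1), (cells k (\<lambda>_. 2), int (Suc k) - 1)])"

lemma init_skip:
  assumes "sym z \<noteq> 0" "sym z \<noteq> 3"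
  shows "runs 1 (init_cfg z k) (init_cfg (Suc z) k)"
proof (rule runs_step)
  have "cells k (\<lambda>_. 2) (int (Suc k) - 1) = 0"
    by (simp only: cells_at) simp
  then have "delta 0 (inp (int z - 1)) (cells k (\<lambda>_. 2) (int (Suc k) - 1)) = (0, 1, 0, 0)"
    using assms by (simp only: inp_at) (simp add: delta_def)
  from step_shop_tm[where c = inp and h = "int z - 1" and v = "cells k (\<lambda>_. 2)" and
      i = "int (Suc k) - 1", OF this] cells_upd_blank[of "Suc k" k "\<lambda>_. 2"]
  show "step shop_tm (init_cfg z k) = init_cfg (Suc z) k"
    by (simp add: init_cfg_def)
qed

lemma init_mark:
  assumes "sym z = 3"
  shows "runs 1 (init_cfg z k) (init_cfg (Suc z) (Suc k))"
proof (rule runs_step)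
  have "delta 0 (inp (int z - 1)) (cells k (\<lambda>_. 2) (int (Suc k) - 1)) = (0, 1, 2, 1)"
    using assms by (simp only: inp_at) (simp add: delta_def)
  from step_shop_tm[where c = inp and h = "int z - 1" and v = "cells k (\<lambda>_. 2)" and
      i = "int (Suc k) - 1", OF this] cells_upd_new[of k "\<lambda>_. 2" 2]
  show "step shop_tm (init_cfg z k) = init_cfg (Suc z) (Suc k)"
    by (simp add: init_cfg_def fun_upd_idem)
qed

lemma runs_init_caps: "k \<le> m \<Longrightarrow> runs (2 * k) (init_cfg 1 0) (init_cfg (2 * k + 1) k)"
proof (induction k)
  case (Suc k)
  have "sym (2 * k + 1) = 2" "sym (2 * k + 2) = 3"
    using sym_caps[of k 0] sym_caps[of k 1] Suc.prems by auto
  then have "runs 1 (init_cfg (2 * k + 1) k) (init_cfg (2 * k + 2) k)"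
    "runs 1 (init_cfg (2 * k + 2) k) (init_cfg (2 * Suc k + 1) (Suc k))"
    using init_skip[of "2 * k + 1" k] init_mark[of "2 * k + 2" k] by auto
  then have "runs 2 (init_cfg (2 * k + 1) k) (init_cfg (2 * Suc k + 1) (Suc k))"
    by (rule runs_trans) simp
  with Suc show ?case
    by (intro runs_trans[OF Suc.IH]) auto
qed (simp add: runs_refl)

lemma runs_init_rows: "2 * m + d \<le> len \<Longrightarrow> runs (2 * m + d) (init_cfg 1 0) (init_cfg (2 * m + d + 1) m)"
proof (induction d)
  case 0
  then show ?case
    using runs_init_caps[of m] by simp
next
  case (Suc d)
  have "runs 1 (init_cfg (2 * m + d + 1) m) (init_cfg (Suc (2 * m + d + 1)) m)"
    using Suc.prems sym_nonblank sym_after_caps by (intro init_skip) auto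
  then show ?case
    using Suc by (intro runs_trans[OF Suc.IH]) auto
qed

lemma runs_init: "runs (len + 1) (start_config shop_tm (encode S)) (cfg 4 len (Suc m) (marks {1..m} n))"
proof -
  have "2 * m \<le> len"
    by (simp add: len_eq rowend_def)
  then have "runs len (init_cfg 1 0) (init_cfg (Suc len) m)"
    using runs_init_rows[of "len - 2 * m"] by simp
  moreover have "start_config shop_tm (encode S) = init_cfg 1 0"
    using start_config_eq by (simp add: init_cfg_def)
  moreover have "init_cfg (Suc len) m = cfg 0 (Suc len) (Suc m) (marks {1..m} n)"
  proof -
    have "cells m (\<lambda>_. 2) = cells m (marks {1..m} n)"
      by (rule cells_cong) (simp add: marks_end)
    then show ?thesis
      by (simp add: init_cfg_def cfg_def)
  qed
  moreover have "runs 1 (cfg 0 (Suc len) (Suc m) u) (cfg 4 len (Suc m) u)" for u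
    by (rule step_blank[where d = "-1" and e = 0]) (auto simp: delta_def sym_blank)
  ultimately show ?thesis
    by (metis order_refl runs_trans)
qed

lemma shop_tm_decides:
  "\<exists>t \<le> poly [:6, 9, 3:] len. fst ((step shop_tm ^^ t) (start_config shop_tm (encode S))) =
    (if reachable_deadlock S then accept shop_tm else reject shop_tm)"
proof -
  obtain c where c: "runs (Suc m * (3 * len + 5)) (cfg 4 len (Suc m) (marks {1..m} n)) c"
    "fst c = (if \<exists>Y \<subseteq> {1..m}. Y \<noteq> {} \<and> pr Y = Y then 12 else 13)"
    using runs_rounds[of "{1..m}"] by auto
  have "m \<le> len"
    by (simp add: len_eq rowend_def)
  then have "Suc m * (3 * len + 5) \<le> Suc len * (3 * len + 5)"
    by (intro mult_le_mono1) simp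
  \<comment> \<open>The polynomial is \<open>(len + 1) + (len + 1) * (3 * len + 5)\<close>
    multiplied out.\<close>
  then have "len + 1 + Suc m * (3 * len + 5) \<le> poly [:6, 9, 3:] len"
    by (simp add: algebra_simps)
  then have "runs (poly [:6, 9, 3:] len) (start_config shop_tm (encode S)) c"
    using runs_trans[OF runs_init c(1)] by blast
  moreover have "fst c = (if reachable_deadlock S then accept shop_tm else reject shop_tm)"
    using c(2) reachable_deadlock_iff_prune_fixpoint[OF unit] by (simp add: shop_tm_def)
  ultimately show ?thesis
    by (auto simp: runs_def simp del: poly_pCons)
qed

end

theorem theorem8p3:
  "poly_time_solvable unit_capacity_systems encode reachable_deadlock"
  unfolding poly_time_solvable_def
proof (rule exI[of _ shop_tm], rule exI[of _ "[:6, 9, 3:]"], intro conjI ballI)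
  show "wf_tm shop_tm"
    by (rule wf_shop_tm)
  fix S assume "S \<in> unit_capacity_systems"
  then interpret unit_shop S
    by unfold_locales
  show "set (encode S) \<subseteq> {1..<nsymbols shop_tm}"
    using set_encode by (simp add: shop_tm_def)
  show "\<exists>t \<le> poly [:6, 9, 3:] (length (encode S)).
      fst ((step shop_tm ^^ t) (start_config shop_tm (encode S))) =
        (if reachable_deadlock S then accept shop_tm else reject shop_tm)"
    by (rule shop_tm_decides)
qed

end
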